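(* Let $W$ be a Weyl group of type $Y_{a,b,c}$ ($a,b,c\ge1$). Then any real 2-root $\alpha\vee\beta$ of $W$ is an integral linear combination of elements of $\mathcal{B}$ with coefficients of like sign (that is, either all coefficients are $\ge0$ or all are $\le0$).
   Context: $Y_{a,b,c}$ ($a,b,c\ge1$) is the tree with $n=a+b+c+1$ vertices consisting of three paths with $a$, $b$ and $c$ vertices, each joined by one of its endpoints to a common trivalent branch vertex. Its Cartan matrix $A$ has $A_{ii}=2$, $A_{ij}=-1$ if $i,j$ are adjacent, and $A_{ij}=0$ otherwise. $W$ is the group generated by $s_1,\dots,s_n$ subject to $s_i^2=1$, $s_is_j=s_js_i$ if $A_{ij}=0$, and $s_is_js_i=s_js_is_j$ if $A_{ij}=-1$. $V$ is the real vector space with basis the simple roots $\Pi=\{\alpha_1,\dots,\alpha_n\}$, with symmetric bilinear form $B(\alpha_i,\alpha_j)=A_{ij}$, on which $W$ acts by $s_i(v)=v-B(\alpha_i,v)\alpha_i$. A real root is a vector $w(\alpha_i)$ with $w\in W$. For $\alpha,\beta\in V$, $\alpha\vee\beta=\alpha\otimes\beta+\beta\otimes\alpha\in S^2(V)\subseteq V\otimes V$. A real 2-root is an element $\alpha\vee\beta$ with $\alpha,\beta$ real roots such that $B(\alpha,\beta)=0$. Elementary roots. The highest root of a type $D_m$ ($m\ge4$) root system is the sum of the simple roots with coefficient $1$ at the endpoints of the diagram and $2$ at all other vertices. For a simple root $\alpha_i$, a positive root $\beta$ is called elementary with respect to $\alpha_i$ if one of the following holds: (1) $\beta=\alpha_j$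 is a simple root with $A_{ij}=0$; (2) $\beta=\alpha_h+\alpha_i+\alpha_j$ for a path $h$--$i$--$j$ in $Y_{a,b,c}$ (with middle vertex $i$); (3) $i$ is not the branch vertex and $\beta=\theta_i$, where $\theta_i$ is the highest root of the standard parabolic subsystem of type $D_m$ ($m\ge 4$) whose simple roots are those on the path from $i$ to the branch vertex together with all neighbours of the branch vertex. The canonical basis $\mathcal{B}=\mathcal{B}(a,b,c)$ is the set of all $\alpha_i\vee\beta$ with $\alpha_i\in\Pi$ and $\beta$ elementary with respect to $\alpha_i$ (a linearly independent set). *)

theory Defs
  imports "HOL-Algebra.Group" Complex_Main
begin

section \<open>The Dynkin diagram\<close>

datatype arm = ArmA | ArmB | ArmC

text \<open>\<open>Node x k\<close> is the vertex at distance \<open>k \<ge> 1\<close> from the branch vertex on the arm \<open>x\<close>.\<close>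

datatype node = Branch | Node arm nat

fun arm_length :: "nat \<Rightarrow> nat \<Rightarrow> nat \<Rightarrow> arm \<Rightarrow> nat" where
  "arm_length a b c ArmA = a"
| "arm_length a b c ArmB = b"
| "arm_length a b c ArmC = c"

definition verts :: "nat \<Rightarrow> nat \<Rightarrow> nat \<Rightarrow> node set" where
  "verts a b c = insert Branch {Node x k | x k. 1 \<le> k \<and> k \<le> arm_length a b c x}"

fun adjacent :: "node \<Rightarrow> node \<Rightarrow> bool" where
  "adjacent Branch Branch = False"
| "adjacent Branch (Node x k) = (k = 1)"
| "adjacent (Node x k) Branch = (k = 1)"
| "adjacent (Node x k) (Node y l) = (x = y \<and> (l = Suc k \<or> k = Suc l))"

definition cartan :: "node \<Rightarrow> node \<Rightarrow> real" where
  "cartan i j = (if i = j then 2 else if adjacent i j then -1 else 0)"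

lemma finite_verts: "finite (verts a b c)"
proof -
  have "verts a b c \<subseteq> insert Branch
      ((\<lambda>(x, k). Node x k) ` ({ArmA, ArmB, ArmC} \<times> {..a + b + c}))"
  proof
    fix i assume "i \<in> verts a b c"
    then consider "i = Branch" | x k where "i = Node x k" "k \<le> arm_length a b c x"
      unfolding verts_def by blast
    then show "i \<in> insert Branch
      ((\<lambda>(x, k). Node x k) ` ({ArmA, ArmB, ArmC} \<times> {..a + b + c}))"
    proof cases
      case 2
      then show ?thesis by (cases x) (auto simp: image_iff)
    qed simp
  qed
  then show ?thesis by (rule finite_subset) auto
qed

lemma card_verts: "card (verts a b c) = a + b + c + 1"
proof -
  have *: "verts a b c = insert Branch
      (Node ArmA ` {1..a} \<union> (Node ArmB ` {1..b} \<union> Node ArmC ` {1..c}))"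
    (is "_ = insert Branch (?A \<union> (?B \<union> ?C))")
  proof (rule Set.set_eqI)
    fix i
    show "i \<in> verts a b c \<longleftrightarrow> i \<in> insert Branch (?A \<union> (?B \<union> ?C))"
    proof (cases i)
      case (Node x k)
      then show ?thesis by (cases x) (auto simp: verts_def)
    qed (simp add: verts_def)
  qed
  have i: "inj_on (Node x) S" for x S by (simp add: inj_on_def)
  have "card (?A \<union> (?B \<union> ?C)) = a + (b + c)"
    by (subst card_Un_disjoint, simp, simp, blast, subst card_Un_disjoint)
       (auto simp: card_image[OF i])
  moreover have "Branch \<notin> ?A \<union> (?B \<union> ?C)" by blast
  ultimately show ?thesis unfolding * by simp
qed


section \<open>The Weyl group\<close>

text \<open>Words in the generators. Since the relations make every generator an involution, the
  monoid presented this way is already the presented group (\<open>group_weyl_group\<close> below).\<close>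

inductive word_eq :: "nat \<Rightarrow> nat \<Rightarrow> nat \<Rightarrow> node list \<Rightarrow> node list \<Rightarrow> bool"
  for a b c :: nat where
  refl: "u \<in> lists (verts a b c) \<Longrightarrow> word_eq a b c u u"
| sym: "word_eq a b c u v \<Longrightarrow> word_eq a b c v u"
| trans: "word_eq a b c u v \<Longrightarrow> word_eq a b c v w \<Longrightarrow> word_eq a b c u w"
| append: "word_eq a b c u u' \<Longrightarrow> word_eq a b c v v' \<Longrightarrow> word_eq a b c (u @ v) (u' @ v')"
| involution: "i \<in> verts a b c \<Longrightarrow> word_eq a b c [i, i] []"
| commute: "i \<in> verts a b c \<Longrightarrow> j \<in> verts a b c \<Longrightarrow> cartan i j = 0 \<Longrightarrow>
    word_eq a b c [i, j] [j, i]"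
| braid: "i \<in> verts a b c \<Longrightarrow> j \<in> verts a b c \<Longrightarrow> cartan i j = -1 \<Longrightarrow>
    word_eq a b c [i, j, i] [j, i, j]"

definition word_rel :: "nat \<Rightarrow> nat \<Rightarrow> nat \<Rightarrow> (node list \<times> node list) set" where
  "word_rel a b c = {(u, v). word_eq a b c u v}"

definition weyl_group :: "nat \<Rightarrow> nat \<Rightarrow> nat \<Rightarrow> node list set monoid" where
  "weyl_group a b c =
    \<lparr>carrier = lists (verts a b c) // word_rel a b c,
     monoid.mult = (\<lambda>X Y. \<Union>u\<in>X. \<Union>v\<in>Y. word_rel a b c `` {u @ v}),
     one = word_rel a b c `` {[]}\<rparr>"

lemma word_eq_lists:
  "word_eq a b c u v \<Longrightarrow> u \<in> lists (verts a b c) \<and> v \<in> lists (verts a b c)"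
  by (induction rule: word_eq.induct) auto

lemma equiv_word_rel: "equiv (lists (verts a b c)) (word_rel a b c)"
proof (rule equivI)
  show "word_rel a b c \<subseteq> lists (verts a b c) \<times> lists (verts a b c)"
    unfolding word_rel_def by (auto dest: word_eq_lists)
  show "refl_on (lists (verts a b c)) (word_rel a b c)"
    unfolding word_rel_def refl_on_def by (auto intro: word_eq.refl)
  show "sym (word_rel a b c)"
    unfolding word_rel_def sym_def by (auto intro: word_eq.sym)
  show "trans (word_rel a b c)"
    unfolding word_rel_def trans_def by (auto intro: word_eq.trans)
qed

lemma word_rel_append:
  "congruent2 (word_rel a b c) (word_rel a b c) (\<lambda>u v. word_rel a b c `` {u @ v})"
proof -
  have "word_rel a b c `` {u @ v} = word_rel a b c `` {u' @ v'}"
    if "word_eq a b c u u'" "word_eq a b c v v'" for u u' v v'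
    using equiv_class_eq[OF equiv_word_rel] word_eq.append[OF that]
    by (simp add: word_rel_def)
  then show ?thesis by (auto simp: congruent2_def word_rel_def)
qed

lemma weyl_group_mult_class:
  assumes "u \<in> lists (verts a b c)" "v \<in> lists (verts a b c)"
  shows "word_rel a b c `` {u} \<otimes>\<^bsub>weyl_group a b c\<^esub> word_rel a b c `` {v} =
    word_rel a b c `` {u @ v}"
  using UN_equiv_class2[OF equiv_word_rel equiv_word_rel word_rel_append assms]
  by (simp add: weyl_group_def)

lemma word_eq_rev: "u \<in> lists (verts a b c) \<Longrightarrow> word_eq a b c (rev u @ u) []"
proof (induction u)
  case Nil
  show ?case by (simp add: word_eq.refl)
next
  case (Cons i u)
  then have i: "i \<in> verts a b c" and u: "u \<in> lists (verts a b c)" by auto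
  then have r: "rev u \<in> lists (verts a b c)" by auto
  have "word_eq a b c (rev u @ ([i, i] @ u)) (rev u @ ([] @ u))"
    by (intro word_eq.append word_eq.involution word_eq.refl i u r)
  then show ?case using Cons.IH[OF u] by (auto intro: word_eq.trans)
qed

lemma group_weyl_group: "group (weyl_group a b c)"
proof (rule groupI)
  let ?W = "weyl_group a b c" and ?R = "word_rel a b c"
  have carr: "\<And>u. u \<in> lists (verts a b c) \<Longrightarrow> ?R `` {u} \<in> carrier ?W"
    by (simp add: weyl_group_def quotientI)
  have ex: "\<exists>u \<in> lists (verts a b c). x = ?R `` {u}" if "x \<in> carrier ?W" for x
    using that by (auto simp: weyl_group_def elim: quotientE)
  have one: "\<one>\<^bsub>?W\<^esub> = ?R `` {[]}" by (simp add: weyl_group_def)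
  show "\<one>\<^bsub>?W\<^esub> \<in> carrier ?W" unfolding one by (rule carr) simp
  show "x \<otimes>\<^bsub>?W\<^esub> y \<in> carrier ?W" if p: "x \<in> carrier ?W" "y \<in> carrier ?W" for x y
  proof -
    obtain u v where "u \<in> lists (verts a b c)" "x = ?R `` {u}"
      "v \<in> lists (verts a b c)" "y = ?R `` {v}"
      using ex[OF p(1)] ex[OF p(2)] by blast
    then show ?thesis using carr[of "u @ v"] by (simp add: weyl_group_mult_class)
  qed
  show "x \<otimes>\<^bsub>?W\<^esub> y \<otimes>\<^bsub>?W\<^esub> z = x \<otimes>\<^bsub>?W\<^esub> (y \<otimes>\<^bsub>?W\<^esub> z)"
    if p: "x \<in> carrier ?W" "y \<in> carrier ?W" "z \<in> carrier ?W" for x y z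
  proof -
    obtain u v w where "u \<in> lists (verts a b c)" "x = ?R `` {u}"
      "v \<in> lists (verts a b c)" "y = ?R `` {v}" "w \<in> lists (verts a b c)" "z = ?R `` {w}"
      using ex[OF p(1)] ex[OF p(2)] ex[OF p(3)] by blast
    then show ?thesis by (simp add: weyl_group_mult_class)
  qed
  show "\<one>\<^bsub>?W\<^esub> \<otimes>\<^bsub>?W\<^esub> x = x" if "x \<in> carrier ?W" for x
    using ex[OF that] weyl_group_mult_class[of "[]"] one by force
  show "\<exists>y\<in>carrier ?W. y \<otimes>\<^bsub>?W\<^esub> x = \<one>\<^bsub>?W\<^esub>" if x: "x \<in> carrier ?W" for x
  proof -
    obtain u where u: "u \<in> lists (verts a b c)" "x = ?R `` {u}" using ex[OF x] by blast
    then have r: "rev u \<in> lists (verts a b c)" by auto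
    have "?R `` {rev u @ u} = ?R `` {[]}"
      using word_eq_rev[OF u(1)] equiv_class_eq[OF equiv_word_rel] by (simp add: word_rel_def)
    then show ?thesis using weyl_group_mult_class[OF r u(1)] carr[OF r] u(2) one by metis
  qed
qed


section \<open>The reflection representation and real roots\<close>

text \<open>\<open>V\<close> is \<open>root_space a b c\<close>: the functions vanishing off \<open>verts a b c\<close>, which are the coordinate
  vectors with respect to the basis of simple roots.\<close>

type_synonym vect = "node \<Rightarrow> real"

definition root_space :: "nat \<Rightarrow> nat \<Rightarrow> nat \<Rightarrow> vect set" where
  "root_space a b c = {v. \<forall>i. i \<notin> verts a b c \<longrightarrow> v i = 0}"

definition simple_root :: "node \<Rightarrow> vect" where
  "simple_root i = (\<lambda>j. if j = i then 1 else 0)"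

definition bform :: "nat \<Rightarrow> nat \<Rightarrow> nat \<Rightarrow> vect \<Rightarrow> vect \<Rightarrow> real" where
  "bform a b c v w = (\<Sum>i\<in>verts a b c. \<Sum>j\<in>verts a b c. v i * w j * cartan i j)"

definition reflect :: "nat \<Rightarrow> nat \<Rightarrow> nat \<Rightarrow> node \<Rightarrow> vect \<Rightarrow> vect" where
  "reflect a b c i v = (\<lambda>j. v j - bform a b c (simple_root i) v * simple_root i j)"

definition word_act :: "nat \<Rightarrow> nat \<Rightarrow> nat \<Rightarrow> node list \<Rightarrow> vect \<Rightarrow> vect" where
  "word_act a b c u v = foldr (reflect a b c) u v"

text \<open>The value does not depend on the chosen representative: see \<open>weyl_act_class\<close> below.\<close>

definition weyl_act :: "nat \<Rightarrow> nat \<Rightarrow> nat \<Rightarrow> node list set \<Rightarrow> vect \<Rightarrow> vect" where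
  "weyl_act a b c w v = word_act a b c (SOME u. u \<in> w) v"

definition real_roots :: "nat \<Rightarrow> nat \<Rightarrow> nat \<Rightarrow> vect set" where
  "real_roots a b c =
    {weyl_act a b c w (simple_root i) | w i. w \<in> carrier (weyl_group a b c) \<and> i \<in> verts a b c}"

definition positive_roots :: "nat \<Rightarrow> nat \<Rightarrow> nat \<Rightarrow> vect set" where
  "positive_roots a b c = {\<beta> \<in> real_roots a b c. \<forall>i \<in> verts a b c. \<beta> i \<ge> 0}"

lemma bform_simple_root:
  assumes "i \<in> verts a b c"
  shows "bform a b c (simple_root i) v = (\<Sum>j\<in>verts a b c. v j * cartan i j)"
proof -
  have "bform a b c (simple_root i) v =
      (\<Sum>k\<in>verts a b c. if k = i then \<Sum>j\<in>verts a b c. v j * cartan i j else 0)"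
    unfolding bform_def simple_root_def by (intro sum.cong) auto
  then show ?thesis using assms finite_verts by simp
qed

lemma bform_simple_simple:
  assumes "i \<in> verts a b c" "j \<in> verts a b c"
  shows "bform a b c (simple_root i) (simple_root j) = cartan i j"
proof -
  have "bform a b c (simple_root i) (simple_root j) =
      (\<Sum>k\<in>verts a b c. if k = j then cartan i j else 0)"
    unfolding bform_simple_root[OF assms(1)] by (intro sum.cong) (auto simp: simple_root_def)
  then show ?thesis using assms(2) finite_verts by simp
qed

lemma cartan_sym: "cartan i j = cartan j i"
  by (cases i; cases j) (auto simp: cartan_def)

lemma bform_simple_reflect:
  assumes "i \<in> verts a b c" "k \<in> verts a b c"
  shows "bform a b c (simple_root k) (reflect a b c i v) =
    bform a b c (simple_root k) v - bform a b c (simple_root i) v * cartan k i"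
proof -
  have "bform a b c (simple_root k) (reflect a b c i v) =
      bform a b c (simple_root k) v -
      bform a b c (simple_root i) v * bform a b c (simple_root k) (simple_root i)"
    by (simp add: bform_simple_root[OF assms(2)] reflect_def algebra_simps
        sum_subtractf sum_distrib_left)
  then show ?thesis using bform_simple_simple assms by simp
qed

lemma word_act_append: "word_act a b c (u @ v) x = word_act a b c u (word_act a b c v x)"
  by (simp add: word_act_def)

lemma word_act_cong: "word_eq a b c u v \<Longrightarrow> word_act a b c u x = word_act a b c v x"
proof (induction arbitrary: x rule: word_eq.induct)
  case (append u u' v v')
  then show ?case by (simp add: word_act_append)
next
  case (involution i)
  have "reflect a b c i (reflect a b c i x) j = x j" for j
    by (subst reflect_def, simp only: bform_simple_reflect[OF involution involution])
       (simp add: reflect_def cartan_def algebra_simps)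
  then show ?case by (simp add: word_act_def fun_eq_iff)
next
  case (commute i j)
  have "cartan j i = 0" using commute(3) cartan_sym by simp
  then have "reflect a b c i (reflect a b c j x) k = reflect a b c j (reflect a b c i x) k" for k
    using commute(3)
    by (subst (1 3) reflect_def, simp only: bform_simple_reflect commute)
       (simp add: reflect_def algebra_simps)
  then show ?case by (simp add: word_act_def fun_eq_iff)
next
  case (braid i j)
  have c: "cartan j i = -1" "cartan i i = 2" "cartan j j = 2"
    using braid(3) cartan_sym[of i j] by (simp, simp_all add: cartan_def)
  have r: "reflect a b c l y k = y k - bform a b c (simple_root l) y * simple_root l k"
    for l y k by (simp add: reflect_def)
  have L: "reflect a b c l (reflect a b c m (reflect a b c l x)) k =
      x k - bform a b c (simple_root l) x * simple_root l k
      - bform a b c (simple_root m) (reflect a b c l x) * simple_root m k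
      - bform a b c (simple_root l) (reflect a b c m (reflect a b c l x)) * simple_root l k"
    for l m k
    using r[of l "reflect a b c m (reflect a b c l x)" k] r[of m "reflect a b c l x" k]
      r[of l x k] by linarith
  have "reflect a b c i (reflect a b c j (reflect a b c i x)) k =
      reflect a b c j (reflect a b c i (reflect a b c j x)) k" for k
    unfolding L using braid by (simp add: c bform_simple_reflect algebra_simps)
  then show ?case by (simp add: word_act_def fun_eq_iff)
qed simp_all

lemma weyl_act_class:
  assumes "u \<in> lists (verts a b c)"
  shows "weyl_act a b c (word_rel a b c `` {u}) v = word_act a b c u v"
proof -
  have "u \<in> word_rel a b c `` {u}" using assms by (simp add: word_rel_def word_eq.refl)
  then have "(SOME x. x \<in> word_rel a b c `` {u}) \<in> word_rel a b c `` {u}" by (rule someI)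
  then show ?thesis
    unfolding weyl_act_def using word_act_cong by (fastforce simp: word_rel_def)
qed

lemma simple_root_in_root_space: "i \<in> verts a b c \<Longrightarrow> simple_root i \<in> root_space a b c"
  by (auto simp: simple_root_def root_space_def)

lemma word_act_in_root_space:
  "u \<in> lists (verts a b c) \<Longrightarrow> v \<in> root_space a b c \<Longrightarrow> word_act a b c u v \<in> root_space a b c"
proof (induction u)
  case (Cons i u)
  then show ?case
    by (auto simp: word_act_def reflect_def root_space_def simple_root_def)
qed (simp add: word_act_def)

lemma real_roots_subset: "real_roots a b c \<subseteq> root_space a b c"
proof
  fix v assume "v \<in> real_roots a b c"
  then obtain w i where w: "w \<in> carrier (weyl_group a b c)" and i: "i \<in> verts a b c"
    and v: "v = weyl_act a b c w (simple_root i)"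
    unfolding real_roots_def by blast
  from w obtain u where u: "u \<in> lists (verts a b c)" "w = word_rel a b c `` {u}"
    by (auto simp: weyl_group_def elim!: quotientE)
  show "v \<in> root_space a b c"
    using word_act_in_root_space[OF u(1) simple_root_in_root_space[OF i]]
    by (simp add: v u(2) weyl_act_class[OF u(1)])
qed


section \<open>Real 2-roots and the canonical basis\<close>

text \<open>An element of \<open>V \<otimes> V\<close> is given by its coordinate matrix with respect to the basis of the
  tensors \<open>\<alpha>\<^sub>i \<otimes> \<alpha>\<^sub>j\<close>.\<close>

type_synonym tensor = "node \<Rightarrow> node \<Rightarrow> real"

definition tprod :: "vect \<Rightarrow> vect \<Rightarrow> tensor" where
  "tprod v w = (\<lambda>i j. v i * w j)"

definition vee :: "vect \<Rightarrow> vect \<Rightarrow> tensor" where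
  "vee v w = (\<lambda>i j. tprod v w i j + tprod w v i j)"

definition real_two_roots :: "nat \<Rightarrow> nat \<Rightarrow> nat \<Rightarrow> tensor set" where
  "real_two_roots a b c =
    {vee \<alpha> \<beta> | \<alpha> \<beta>. \<alpha> \<in> real_roots a b c \<and> \<beta> \<in> real_roots a b c \<and> bform a b c \<alpha> \<beta> = 0}"

fun path_to_branch :: "node \<Rightarrow> node set" where
  "path_to_branch Branch = {Branch}"
| "path_to_branch (Node x k) = insert Branch (Node x ` {1..k})"

definition d_support :: "nat \<Rightarrow> nat \<Rightarrow> nat \<Rightarrow> node \<Rightarrow> node set" where
  "d_support a b c i = path_to_branch i \<union> {j \<in> verts a b c. adjacent Branch j}"

text \<open>The highest root of the type \<open>D\<^sub>m\<close> subsystem with diagram the full subgraph on \<open>S\<close>; the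
  endpoints are the vertices with exactly one neighbour in \<open>S\<close>.\<close>

definition d_highest_root :: "node set \<Rightarrow> vect" where
  "d_highest_root S =
    (\<lambda>j. if j \<notin> S then 0 else if card {k \<in> S. adjacent j k} = 1 then 1 else 2)"

definition elementary :: "nat \<Rightarrow> nat \<Rightarrow> nat \<Rightarrow> node \<Rightarrow> vect \<Rightarrow> bool" where
  "elementary a b c i \<beta> \<longleftrightarrow> \<beta> \<in> positive_roots a b c \<and>
    ((\<exists>j \<in> verts a b c. \<beta> = simple_root j \<and> cartan i j = 0) \<or>
     (\<exists>h \<in> verts a b c. \<exists>j \<in> verts a b c. h \<noteq> j \<and> adjacent h i \<and> adjacent i j \<and>
        \<beta> = (\<lambda>k. simple_root h k + simple_root i k + simple_root j k)) \<or>
     (i \<noteq> Branch \<and> \<beta> = d_highest_root (d_support a b c i)))"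

definition canonical_basis :: "nat \<Rightarrow> nat \<Rightarrow> nat \<Rightarrow> tensor set" where
  "canonical_basis a b c =
    {vee (simple_root i) \<beta> | i \<beta>. i \<in> verts a b c \<and> elementary a b c i \<beta>}"

lemma finite_canonical_basis: "finite (canonical_basis a b c)"
proof -
  let ?V = "verts a b c"
  let ?E = "\<lambda>i. simple_root ` ?V \<union>
    (\<lambda>(h, j) k. simple_root h k + simple_root i k + simple_root j k) ` (?V \<times> ?V) \<union>
    {d_highest_root (d_support a b c i)}"
  have "canonical_basis a b c \<subseteq> (\<Union>i\<in>?V. vee (simple_root i) ` ?E i)"
    unfolding canonical_basis_def elementary_def by fast
  moreover have "finite (\<Union>i\<in>?V. vee (simple_root i) ` ?E i)"
    using finite_verts by blast
  ultimately show ?thesis by (rule finite_subset)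
qed

end

theory Submission
  imports Defs
begin

text \<open>The idea is to write down the coefficients of \<open>p \<or> q\<close> in the canonical basis explicitly and to
  check that they are nonnegative integers when \<open>p\<close> and \<open>q\<close> are orthogonal positive roots. This is
  enough, because every real root is positive or negative (\<open>real_root_sign\<close>).

  On each arm of the diagram, replace the coordinates of a vector by their successive differences
  (\<open>gap\<close>). In these coordinates \<open>B(p, q)\<close> is the sum of the products of corresponding gaps minus
  the product of the coordinates at the branch vertex (\<open>form_eq_tails\<close>), and the reflections in
  the vertices of an arm permute the gaps of that arm. Consequently a positive root with positive
  branch coordinate has only nonnegative gaps (\<open>gap_nonneg\<close>), while the other positive roots are roots of type \<open>A\<close> on a
  single arm (\<open>Pos_Branch_zero\<close>). One reflection in the branch vertex gives a further inequality:
  up to one explicit exception, two gaps on different arms add up to at most the branch coordinate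
  (\<open>two_gaps_le_Branch\<close>).

  Let \<open>T(x, k)\<close> be the sum of the products of the gaps of \<open>p\<close> and \<open>q\<close> on the arm \<open>x\<close>
  from position \<open>k\<close> outwards (\<open>tail\<close>). Comparing the diagonal entries and the entries at the edges of
  the coordinate matrix, one finds that the basis element formed with \<open>\<theta>\<^sub>i\<close>, for \<open>i\<close> at distance \<open>k\<close>
  on the arm \<open>x\<close>, has coefficient \<open>T(x, k)\<close>, that the path with middle vertex \<open>i\<close> has coefficient
  \<open>p\<^sub>i q\<^sub>i - T(x, k)\<close>, and that the path through the branch vertex avoiding the arm \<open>x\<close> has
  coefficient \<open>T(x, 0)\<close>. These account for the diagonal and the edges; in the case of the diagonal
  entry at the branch vertex this is the orthogonality of the two roots. The element
  \<open>\<alpha>\<^sub>i \<or> \<alpha>\<^sub>j\<close> for nonadjacent \<open>i\<close>, \<open>j\<close> then takes whatever remains of the entry at \<open>(i, j)\<close>.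
  That all these numbers are nonnegative is the content of the inequalities \<open>tail_nonneg\<close>,
  \<open>tail_le_product\<close>, \<open>tail_le_same_arm\<close>, \<open>tail_le_cross_arm\<close> and
  \<open>tails_le_Branch_neighbours\<close>.\<close>

locale Y_diagram =
  fixes a b c :: nat
  assumes arms_nonempty: "a \<ge> 1" "b \<ge> 1" "c \<ge> 1"
begin

abbreviation "V \<equiv> verts a b c"
abbreviation "len \<equiv> arm_length a b c"
abbreviation "form \<equiv> bform a b c"
abbreviation "s \<equiv> reflect a b c"

lemma len_pos: "len x \<ge> 1"
  using arms_nonempty by (cases x) auto

section \<open>Every real root is positive or negative\<close>

text \<open>Positive roots are built from simple roots by reflections that add a positive multiple of
  a simple root, which makes nonnegativity of their coordinates evident. The counter is the number
  of steps; it serves as induction measure when a root is lowered again. That these vectors and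
  their negatives exhaust the real roots is then a statement about closure under reflections.\<close>

inductive pos_root :: "nat \<Rightarrow> vect \<Rightarrow> bool" where
  simple: "i \<in> V \<Longrightarrow> pos_root 0 (simple_root i)"
| raise: "pos_root n v \<Longrightarrow> i \<in> V \<Longrightarrow> form (simple_root i) v < 0 \<Longrightarrow> pos_root (Suc n) (s i v)"

definition Pos :: "vect set" where
  "Pos = {v. \<exists>n. pos_root n v}"

lemma reflect_reflect: "i \<in> V \<Longrightarrow> s i (s i v) = v"
  using word_act_cong[OF word_eq.involution, of i a b c v] by (simp add: word_act_def)

lemma reflect_commute: "i \<in> V \<Longrightarrow> j \<in> V \<Longrightarrow> cartan i j = 0 \<Longrightarrow> s i (s j v) = s j (s i v)"
  using word_act_cong[OF word_eq.commute, of i a b c j v] by (simp add: word_act_def)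

lemma reflect_braid:
  "i \<in> V \<Longrightarrow> j \<in> V \<Longrightarrow> cartan i j = -1 \<Longrightarrow> s i (s j (s i v)) = s j (s i (s j v))"
  using word_act_cong[OF word_eq.braid, of i a b c j v] by (simp add: word_act_def)

lemma reflect_simple_self: "i \<in> V \<Longrightarrow> s i (simple_root i) = (\<lambda>j. - simple_root i j)"
  by (rule ext) (simp add: reflect_def bform_simple_simple cartan_def)

lemma reflect_reflect_adjacent_simple:
  assumes "i \<in> V" "j \<in> V" "cartan i j = -1"
  shows "s i (s j (simple_root i)) = simple_root j"
proof
  fix k
  have "i \<noteq> j" using assms(3) by (auto simp: cartan_def)
  have ji: "form (simple_root j) (simple_root i) = -1"
    using assms bform_simple_simple cartan_sym[of i j] by simp
  have "form (simple_root i) (s j (simple_root i)) = 1"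
    using assms ji by (simp add: bform_simple_reflect bform_simple_simple) (simp add: cartan_def)
  then show "s i (s j (simple_root i)) k = simple_root j k"
    by (subst reflect_def) (simp add: reflect_def[of _ _ _ j] ji)
qed

text \<open>This plays the role of the length function of a Coxeter group: a reflection that subtracts
  from a positive root either negates it, if the root is simple, or leads to a root with a shorter
  derivation. Let \<open>v = s\<^sub>j u\<close> be the last step of the derivation. If \<open>s\<^sub>i\<close> commutes with \<open>s\<^sub>j\<close>, then
  lower \<open>u\<close> by \<open>s\<^sub>i\<close> and raise the result by \<open>s\<^sub>j\<close>. If \<open>s\<^sub>i\<close> and \<open>s\<^sub>j\<close> braid, then \<open>B(\<alpha>\<^sub>i, v) > 0\<close> forces
  \<open>B(\<alpha>\<^sub>i, u) > - B(\<alpha>\<^sub>j, u) > 0\<close>, so \<open>u\<close> can be lowered by \<open>s\<^sub>i\<close> and then by \<open>s\<^sub>j\<close>; raising by \<open>s\<^sub>i\<close>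
  and then by \<open>s\<^sub>j\<close> gives \<open>s\<^sub>i v\<close> by the braid relation.\<close>

lemma pos_root_lower:
  assumes "pos_root n v" "i \<in> V" "0 < form (simple_root i) v"
  shows "v = simple_root i \<or> (\<exists>m<n. pos_root m (s i v))"
  using assms
proof (induction n arbitrary: v i rule: less_induct)
  case (less n)
  note i = \<open>i \<in> V\<close>
  from less.prems(1) show ?case
  proof cases
    case (simple j)
    then show ?thesis
      using less.prems bform_simple_simple[OF i simple(3)] by (auto simp: cartan_def split: if_splits)
  next
    case (raise n' u j)
    note j = \<open>j \<in> V\<close> and u = \<open>pos_root n' u\<close>
    let ?gi = "form (simple_root i)" and ?gj = "form (simple_root j)"
    have gi: "?gi (s k w) = ?gi w - form (simple_root k) w * cartan i k" if "k \<in> V" for k w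
      using bform_simple_reflect[OF that i] .
    have gj: "?gj (s k w) = ?gj w - form (simple_root k) w * cartan j k" if "k \<in> V" for k w
      using bform_simple_reflect[OF that j] .
    have c2: "cartan i i = 2" "cartan j j = 2" by (auto simp: cartan_def)
    have IH: "w = simple_root k \<or> (\<exists>m<n''. pos_root m (s k w))"
      if "n'' < n" "pos_root n'' w" "k \<in> V" "0 < form (simple_root k) w" for n'' w k
      using less.IH that by blast
    consider "i = j" | "i \<noteq> j" "cartan i j = 0" | "cartan i j = -1"
      by (cases "i = j"; cases "adjacent i j") (simp_all add: cartan_def)
    then show ?thesis
    proof cases
      case 1
      then show ?thesis using raise reflect_reflect[OF j] by auto
    next
      case 2
      have cji: "cartan j i = 0" using 2 cartan_sym by simp
      have "0 < ?gi u" using less.prems(3) raise gi[OF j] 2 by simp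
      moreover have "u \<noteq> simple_root i"
        using raise(5) cji bform_simple_simple[OF j i] by auto
      ultimately obtain m where m: "m < n'" "pos_root m (s i u)"
        using IH[of n' u i] u i raise(1) by auto
      have "?gj (s i u) < 0" using gj[OF i] cji raise(5) by simp
      from pos_root.raise[OF m(2) j this] have "pos_root (Suc m) (s i v)"
        using reflect_commute[OF i j 2(2)] raise by simp
      then show ?thesis using m raise(1) by (intro disjI2 exI[of _ "Suc m"]) simp
    next
      case 3
      have cji: "cartan j i = -1" using 3 cartan_sym by simp
      have big: "?gi u > - ?gj u" using less.prems(3) raise gi[OF j] 3 by simp
      show ?thesis
      proof (cases "u = simple_root i")
        case True
        then have "s i v = simple_root j"
          using reflect_reflect_adjacent_simple[OF i j 3] raise by simp
        then show ?thesis using pos_root.simple[OF j] raise(1) by auto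
      next
        case False
        then obtain m where m: "m < n'" "pos_root m (s i u)"
          using IH[of n' u i] u i raise(1,5) big by auto
        have gju: "?gj (s i u) = ?gj u + ?gi u" using gj[OF i] cji by simp
        have giu: "?gi (s i u) = - ?gi u" using gi[OF i] c2 by simp
        \<comment> \<open>Otherwise \<open>u = \<alpha>\<^sub>i + \<alpha>\<^sub>j\<close>, and \<open>B(\<alpha>\<^sub>j, u) = 1\<close> contradicts that \<open>s\<^sub>j\<close> raises \<open>u\<close>.\<close>
        have "s i u \<noteq> simple_root j"
        proof
          assume "s i u = simple_root j"
          then have "?gj u + ?gi u = 2" "- ?gi u = -1"
            using gju giu 3 c2 bform_simple_simple[OF i j] bform_simple_simple[OF j j] by auto
          then show False using raise(5) by simp
        qed
        then obtain m' where m': "m' < m" "pos_root m' (s j (s i u))"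
          using IH[of m "s i u" j] m j gju big raise(1) by force
        let ?w = "s j (s i u)"
        have giw: "?gi ?w = ?gj u" using gi[OF j] gju giu 3 by simp
        have gjw: "?gj ?w = - ?gj u - ?gi u" using gj[OF j] gju c2 by simp
        have "pos_root (Suc m') (s i ?w)"
          using pos_root.raise[OF m'(2) i] giw raise(5) by simp
        moreover have "?gj (s i ?w) < 0"
          using gj[OF i] gjw giw cji raise(5) big by simp
        ultimately have "pos_root (Suc (Suc m')) (s j (s i ?w))"
          using pos_root.raise j by blast
        moreover have "s j (s i ?w) = s i v"
          using reflect_braid[OF i j 3, of u] reflect_reflect[OF j] raise by simp
        ultimately show ?thesis
          using m m' raise(1) by (intro disjI2 exI[of _ "Suc (Suc m')"]) simp
      qed
    qed
  qed
qed

lemma Pos_simple: "i \<in> V \<Longrightarrow> simple_root i \<in> Pos"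
  unfolding Pos_def using pos_root.simple by blast

lemma Pos_raise: "v \<in> Pos \<Longrightarrow> i \<in> V \<Longrightarrow> form (simple_root i) v < 0 \<Longrightarrow> s i v \<in> Pos"
  unfolding Pos_def using pos_root.raise by blast

lemma Pos_induct [consumes 1, case_names simple raise]:
  assumes "v \<in> Pos"
    and "\<And>i. i \<in> V \<Longrightarrow> Q (simple_root i)"
    and "\<And>v i. v \<in> Pos \<Longrightarrow> Q v \<Longrightarrow> i \<in> V \<Longrightarrow> form (simple_root i) v < 0 \<Longrightarrow> Q (s i v)"
  shows "Q v"
proof -
  obtain n where "pos_root n v" using assms(1) Pos_def by blast
  then show ?thesis
    by (induction rule: pos_root.induct) (use assms(2,3) Pos_def in auto)
qed

lemma Pos_reflect:
  assumes "v \<in> Pos" "i \<in> V"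
  shows "v = simple_root i \<or> s i v \<in> Pos"
proof (cases "form (simple_root i) v" "0 :: real" rule: linorder_cases)
  case less
  then show ?thesis using Pos_raise assms by blast
next
  case equal
  then show ?thesis using assms by (simp add: reflect_def)
next
  case greater
  then show ?thesis using pos_root_lower[OF _ assms(2)] assms(1) unfolding Pos_def by blast
qed

lemma Pos_nonneg: "v \<in> Pos \<Longrightarrow> v i \<ge> 0"
proof (induction arbitrary: i rule: Pos_induct)
  case (raise v j)
  have "form (simple_root j) v * simple_root j i \<le> 0"
    using raise.hyps(3) by (simp add: simple_root_def)
  then show ?case using raise.IH[of i] by (simp add: reflect_def)
qed (simp add: simple_root_def)

lemma Pos_root_space: "v \<in> Pos \<Longrightarrow> i \<notin> V \<Longrightarrow> v i = 0"
proof (induction arbitrary: i rule: Pos_induct)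
  case (raise v j)
  then show ?case by (auto simp: reflect_def simple_root_def)
qed (auto simp: simple_root_def)

lemma Pos_Ints: "v \<in> Pos \<Longrightarrow> v i \<in> \<int>"
proof (induction arbitrary: i rule: Pos_induct)
  case (raise v j)
  have "form (simple_root j) v \<in> \<int>"
    unfolding bform_simple_root[OF raise.hyps(2)]
    by (intro Ints_sum Ints_mult raise.IH) (auto simp: cartan_def)
  then show ?case unfolding reflect_def
    by (intro Ints_diff Ints_mult raise.IH) (auto simp: simple_root_def)
qed (simp add: simple_root_def)

lemma real_roots_word_act:
  "real_roots a b c = {word_act a b c u (simple_root i) | u i. u \<in> lists V \<and> i \<in> V}"
proof -
  have carrier: "carrier (weyl_group a b c) = (\<lambda>u. word_rel a b c `` {u}) ` lists V"
    by (auto simp: weyl_group_def quotient_def)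
  have "real_roots a b c =
      {weyl_act a b c (word_rel a b c `` {u}) (simple_root i) | u i. u \<in> lists V \<and> i \<in> V}"
    unfolding real_roots_def carrier by blast
  also have "\<dots> = {word_act a b c u (simple_root i) | u i. u \<in> lists V \<and> i \<in> V}"
    by (intro Collect_cong ex_cong1) (metis weyl_act_class)
  finally show ?thesis .
qed

lemma reflect_uminus: "i \<in> V \<Longrightarrow> s i (\<lambda>j. - v j) = (\<lambda>j. - s i v j)"
  by (rule ext) (simp add: reflect_def bform_simple_root sum_negf)

lemma real_root_sign:
  assumes "v \<in> real_roots a b c"
  shows "v \<in> Pos \<or> (\<lambda>j. - v j) \<in> Pos"
proof -
  have "word_act a b c u (simple_root i) \<in> Pos \<or> (\<lambda>j. - word_act a b c u (simple_root i) j) \<in> Pos"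
    if "u \<in> lists V" "i \<in> V" for u i
    using that(1)
  proof (induction u)
    case Nil
    then show ?case using Pos_simple[OF that(2)] by (simp add: word_act_def)
  next
    case (Cons j u)
    have *: "s j v \<in> Pos \<or> (\<lambda>k. - s j v k) \<in> Pos" if "v \<in> Pos" for v
      using Pos_reflect[OF that] reflect_simple_self Pos_simple Cons(1) by fastforce
    have "word_act a b c (j # u) w = s j (word_act a b c u w)" for w by (simp add: word_act_def)
    then show ?case
      using * *[of "\<lambda>k. - word_act a b c u (simple_root i) k"] Cons reflect_uminus by auto
  qed
  then show ?thesis using assms unfolding real_roots_word_act by blast
qed

lemma Pos_real_root: "v \<in> Pos \<Longrightarrow> v \<in> real_roots a b c"
proof (induction rule: Pos_induct)
  case (simple i)
  then show ?case unfolding real_roots_word_act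
    by (auto simp: word_act_def intro!: exI[of _ "[]"] exI[of _ i])
next
  case (raise v i)
  then obtain u j where "v = word_act a b c u (simple_root j)" "u \<in> lists V" "j \<in> V"
    unfolding real_roots_word_act by blast
  then show ?case unfolding real_roots_word_act using raise.hyps(2)
    by (auto simp: word_act_def intro!: exI[of _ "i # u"] exI[of _ j])
qed

lemma Pos_positive_root: "v \<in> Pos \<Longrightarrow> v \<in> positive_roots a b c"
  using Pos_real_root Pos_nonneg by (simp add: positive_roots_def)

section \<open>Roots in arm coordinates\<close>

fun arm_node :: "arm \<Rightarrow> nat \<Rightarrow> node" where
  "arm_node x 0 = Branch"
| "arm_node x (Suc k) = Node x (Suc k)"

text \<open>The coordinates of a vector along an arm, read outwards from the branch vertex, are replaced
  by their successive differences. The reflections in the vertices of the arm then permute these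
  differences, as in the standard model of a root system of type \<open>A\<close>, and fix the coordinate at the
  branch vertex.\<close>

definition gap :: "vect \<Rightarrow> arm \<Rightarrow> nat \<Rightarrow> real" where
  "gap v x k = v (arm_node x k) - v (arm_node x (Suc k))"

lemma Node_in_V: "Node x k \<in> V \<longleftrightarrow> 1 \<le> k \<and> k \<le> len x"
  by (auto simp: verts_def)

lemma Branch_in_V: "Branch \<in> V"
  by (simp add: verts_def)

lemma arm_node_in_V: "arm_node x k \<in> V \<longleftrightarrow> k \<le> len x"
  by (cases k) (auto simp: Node_in_V Branch_in_V)

lemma sum_V_support:
  assumes "finite S" "v \<in> root_space a b c" "\<And>j. j \<in> V \<Longrightarrow> j \<notin> S \<Longrightarrow> f j = 0"
  shows "(\<Sum>j\<in>V. v j * f j) = (\<Sum>j\<in>S. v j * f j)"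
proof -
  have "(\<Sum>j\<in>V. v j * f j) = (\<Sum>j\<in>V \<union> S. v j * f j)"
    using assms(1,2) finite_verts by (intro sum.mono_neutral_left) (auto simp: root_space_def)
  also have "\<dots> = (\<Sum>j\<in>S. v j * f j)"
    using assms finite_verts by (intro sum.mono_neutral_right) (auto simp: root_space_def)
  finally show ?thesis .
qed

lemma form_simple_arm:
  assumes "v \<in> root_space a b c" "Suc k \<le> len x"
  shows "form (simple_root (arm_node x (Suc k))) v = gap v x (Suc k) - gap v x k"
proof -
  let ?S = "{arm_node x k, Node x (Suc k), Node x (Suc (Suc k))}"
  have "form (simple_root (Node x (Suc k))) v = (\<Sum>j\<in>V. v j * cartan (Node x (Suc k)) j)"
    using assms by (intro bform_simple_root) (simp add: Node_in_V)
  also have "\<dots> = (\<Sum>j\<in>?S. v j * cartan (Node x (Suc k)) j)"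
  proof (rule sum_V_support[OF _ assms(1)])
    fix j assume "j \<in> V" "j \<notin> ?S"
    then show "cartan (Node x (Suc k)) j = 0"
      by (cases j; cases k) (auto simp: cartan_def Node_in_V)
  qed simp
  also have "\<dots> = gap v x (Suc k) - gap v x k"
    by (cases k) (auto simp: cartan_def gap_def)
  finally show ?thesis by simp
qed

lemma form_simple_Branch:
  assumes "v \<in> root_space a b c"
  shows "form (simple_root Branch) v =
    2 * v Branch - v (Node ArmA 1) - v (Node ArmB 1) - v (Node ArmC 1)"
proof -
  let ?S = "{Branch, Node ArmA 1, Node ArmB 1, Node ArmC 1}"
  have "form (simple_root Branch) v = (\<Sum>j\<in>V. v j * cartan Branch j)"
    by (intro bform_simple_root Branch_in_V)
  also have "\<dots> = (\<Sum>j\<in>?S. v j * cartan Branch j)"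
  proof (rule sum_V_support[OF _ assms])
    fix j assume *: "j \<notin> ?S"
    show "cartan Branch j = 0"
    proof (cases j)
      case (Node x k)
      then show ?thesis using * by (cases x) (auto simp: cartan_def)
    qed (use * in simp)
  qed simp
  also have "\<dots> = 2 * v Branch - v (Node ArmA 1) - v (Node ArmB 1) - v (Node ArmC 1)"
    by (simp add: cartan_def)
  finally show ?thesis .
qed

lemma form_simple_Branch_gap:
  assumes "v \<in> root_space a b c" "x \<noteq> y" "x \<noteq> z" "y \<noteq> z"
  shows "form (simple_root Branch) v = gap v x 0 + gap v y 0 + gap v z 0 - v Branch"
  using assms(2-) form_simple_Branch[OF assms(1)]
  by (cases x; cases y; cases z) (simp_all add: gap_def)

lemma Pos_in_root_space: "v \<in> Pos \<Longrightarrow> v \<in> root_space a b c"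
  by (simp add: root_space_def Pos_root_space)

lemma gap_Ints: "v \<in> Pos \<Longrightarrow> gap v x k \<in> \<int>"
  by (simp add: gap_def Pos_Ints)

lemma gap_last: "v \<in> Pos \<Longrightarrow> gap v x (len x) = v (arm_node x (len x))"
  using Pos_root_space[of v "Node x (Suc (len x))"] by (simp add: gap_def Node_in_V)

text \<open>The reflection in the vertex number \<open>k + 1\<close> of an arm exchanges the gaps on both sides of that
  vertex.\<close>

lemma reflect_arm:
  assumes "v \<in> root_space a b c" "Suc k \<le> len x"
  shows "gap (s (arm_node x (Suc k)) v) x k = gap v x (Suc k)"
    and "gap (s (arm_node x (Suc k)) v) x (Suc k) = gap v x k"
    and "s (arm_node x (Suc k)) v Branch = v Branch"
    and "y \<noteq> x \<Longrightarrow> gap (s (arm_node x (Suc k)) v) y l = gap v y l"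
  using form_simple_arm[OF assms]
  by (cases k; cases l; simp add: reflect_def simple_root_def gap_def)+

lemma Pos_reflect_arm:
  assumes "v \<in> Pos" "0 < v Branch" "Suc k \<le> len x"
  shows "s (arm_node x (Suc k)) v \<in> Pos"
  using Pos_reflect[OF assms(1), of "arm_node x (Suc k)"] assms(2,3)
  by (auto simp: Node_in_V simple_root_def)

text \<open>Since the branch coordinate is positive, every permutation of the gaps of an arm yields
  another positive root. Moving a gap to the end of the arm turns it into a coordinate.\<close>

lemma gap_nonneg:
  assumes "v \<in> Pos" "0 < v Branch" "k \<le> len x"
  shows "gap v x k \<ge> 0"
  using assms(3,1,2)
proof (induction arbitrary: v rule: inc_induct)
  case base
  then show ?case using gap_last Pos_nonneg by simp
next
  case (step k)
  let ?w = "s (arm_node x (Suc k)) v"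
  have "?w \<in> Pos" using Pos_reflect_arm step by simp
  moreover have "gap v x k = gap ?w x (Suc k)" "?w Branch = v Branch"
    using reflect_arm[of v k x] step Pos_in_root_space by auto
  ultimately show ?case using step by simp
qed

definition arm_root :: "arm \<Rightarrow> nat \<Rightarrow> nat \<Rightarrow> vect" where
  "arm_root x j i = (\<lambda>u. of_bool (u \<in> Node x ` {j<..i}))"

lemma arm_root_apply [simp]:
  "arm_root x j i Branch = 0"
  "arm_root x j i (Node y k) = of_bool (y = x \<and> j < k \<and> k \<le> i)"
  by (auto simp: arm_root_def)

lemma arm_root_arm_node: "arm_root x j i (arm_node y k) = of_bool (y = x \<and> j < k \<and> k \<le> i)"
  by (cases k) auto

lemma gap_arm_root:
  assumes "j < i"
  shows "gap (arm_root x j i) y l = of_bool (y = x) * (of_bool (l = i) - of_bool (l = j))"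
  using assms by (auto simp: gap_def arm_root_arm_node)

text \<open>A root that does not involve the branch vertex lives on a single arm, a diagram of type
  \<open>A\<close>, where the roots are the differences of two unit vectors in gap coordinates. During the
  derivation the branch coordinate only grows, so it vanishes throughout.\<close>

lemma Pos_Branch_zero:
  assumes "v \<in> Pos" "v Branch = 0"
  shows "\<exists>x j i. j < i \<and> i \<le> len x \<and> v = arm_root x j i"
  using assms
proof (induction rule: Pos_induct)
  case (simple u)
  then obtain x k where u: "u = Node x (Suc k)" "Suc k \<le> len x"
    by (cases u) (auto simp: simple_root_def Node_in_V dest: Suc_le_D)
  then have "simple_root u = arm_root x k (Suc k)"
    by (auto simp: simple_root_def arm_root_def fun_eq_iff)
  then show ?case using u by (intro exI[of _ x] exI[of _ k] exI[of _ "Suc k"]) simp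
next
  case (raise v u)
  let ?g = "form (simple_root u) v"
  have "v Branch \<ge> 0" using Pos_nonneg raise.hyps by simp
  moreover have "?g * simple_root u Branch \<le> 0"
    using raise.hyps(3) by (intro mult_nonpos_nonneg) (simp_all add: simple_root_def)
  ultimately have v0: "v Branch = 0" and "?g * simple_root u Branch = 0"
    using raise.prems by (auto simp: reflect_def)
  then have "u \<noteq> Branch"
    using raise.hyps(3) by (metis mult_eq_0_iff less_irrefl simple_root_def zero_neq_one)
  then obtain x k where u: "u = arm_node x (Suc k)" "Suc k \<le> len x"
    using raise.hyps by (cases u) (auto simp: Node_in_V dest: Suc_le_D)
  obtain y j i where v: "j < i" "i \<le> len y" "v = arm_root y j i" using raise.IH v0 by blast
  have g: "?g = gap v x (Suc k) - gap v x k"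
    using form_simple_arm u raise.hyps Pos_in_root_space by simp
  have neg: "gap v x (Suc k) < gap v x k" using g raise.hyps by simp
  have xy: "x = y"
  proof (rule ccontr)
    assume "x \<noteq> y"
    then show False using neg v by (simp add: gap_arm_root)
  qed
  have ki: "Suc k = j \<or> k = i"
  proof (rule ccontr)
    assume "\<not> (Suc k = j \<or> k = i)"
    then show False using neg v by (simp add: gap_arm_root of_bool_def split: if_splits)
  qed
  have g1: "?g = -1" using g ki v xy by (auto simp: gap_arm_root)
  then have sv: "s u v = (\<lambda>w. arm_root y j i w + of_bool (w = u))"
    by (auto simp: reflect_def simple_root_def v)
  from ki show ?case
  proof
    assume "Suc k = j"
    then have "s u v = arm_root y k i"
      unfolding sv using u xy v by (intro ext) (auto simp: arm_root_def image_iff)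
    then show ?thesis using v \<open>Suc k = j\<close> by (intro exI[of _ y] exI[of _ k] exI[of _ i]) simp
  next
    assume "k = i"
    then have "s u v = arm_root y j (Suc k)"
      unfolding sv using u xy v by (intro ext) (auto simp: arm_root_def image_iff)
    then show ?thesis using v u xy \<open>k = i\<close>
      by (intro exI[of _ y] exI[of _ j] exI[of _ "Suc k"]) simp
  qed
qed

lemma third_arm: obtains z :: arm where "z \<noteq> x" "z \<noteq> y"
  by (cases x; cases y) auto

text \<open>For \<open>k = 0\<close> the number \<open>v Branch - gap v x 0 - gap v y 0\<close> is the first gap of the
  reflected root \<open>s Branch v\<close> on the third arm, hence nonnegative if the branch coordinate of
  that root is positive. Otherwise \<open>v\<close> is the simple root at the branch vertex or the reflected root
  lives on a single arm; in both cases \<open>v\<close> has branch coordinate \<open>1\<close>, so each of its gaps is \<open>0\<close> or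
  \<open>1\<close>, and the inequality can only fail with \<open>gap v y 0 = 1\<close>. Permuting the gaps of the
  arm \<open>x\<close> reduces general \<open>k\<close> to \<open>k = 0\<close>.\<close>

lemma two_gaps_le_Branch:
  assumes "v \<in> Pos" "0 < v Branch" "x \<noteq> y" "k \<le> len x"
  shows "gap v x k + gap v y 0 \<le> v Branch \<or> v Branch = 1 \<and> gap v y 0 = 1"
  using assms(4,1,2)
proof (induction k arbitrary: v)
  case 0
  obtain z where z: "z \<noteq> x" "z \<noteq> y" using third_arm .
  let ?w = "s Branch v"
  have vr: "v \<in> root_space a b c" using 0 Pos_in_root_space by blast
  have g: "form (simple_root Branch) v = gap v x 0 + gap v y 0 + gap v z 0 - v Branch"
    using form_simple_Branch_gap[OF vr, of x y z] z assms(3) by simp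
  have wB: "?w Branch = v Branch - form (simple_root Branch) v"
    by (simp add: reflect_def simple_root_def)
  have wz: "gap ?w z 0 = v Branch - gap v x 0 - gap v y 0"
    using g wB by (simp add: gap_def reflect_def simple_root_def)
  have nn: "gap v x 0 \<ge> 0" "gap v y 0 \<ge> 0" using gap_nonneg 0 by auto
  consider "v = simple_root Branch" | "?w \<in> Pos" "?w Branch > 0" | "?w \<in> Pos" "?w Branch = 0"
    using Pos_reflect[OF 0(2) Branch_in_V] Pos_nonneg[of ?w Branch] by fastforce
  then show ?case
  proof cases
    case 1
    then show ?thesis by (simp add: gap_def simple_root_def)
  next
    case 2
    then have "gap ?w z 0 \<ge> 0" using gap_nonneg by simp
    then show ?thesis using wz by simp
  next
    case 3
    then obtain t j i where w: "j < i" "i \<le> len t" "?w = arm_root t j i"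
      using Pos_Branch_zero by blast
    \<comment> \<open>Reflecting back gives \<open>v Branch\<close> as the sum of the coordinates of \<open>?w\<close> next to the branch
      vertex, and at most one of them is nonzero.\<close>
    have "gap ?w r 0 = - of_bool (r = t \<and> j = 0)" for r
      using w by (auto simp: gap_arm_root)
    moreover have "v Branch = - (gap ?w x 0 + gap ?w y 0 + gap ?w z 0)"
      using form_simple_Branch_gap[OF Pos_in_root_space[OF 3(1)], of x y z] z assms(3) 3 wB
        bform_simple_reflect[OF Branch_in_V Branch_in_V, of v]
      by (simp add: cartan_def)
    ultimately have v1: "v Branch = 1" using 0(3) z assms(3) by (auto split: if_splits)
    show ?thesis
    proof (cases "gap v y 0 \<ge> 1")
      case True
      have "gap v y 0 \<le> 1" using v1 Pos_nonneg[OF 0(2)] by (simp add: gap_def)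
      then show ?thesis using True v1 by simp
    next
      case False
      then have "gap v y 0 = 0"
        using nn gap_Ints[OF 0(2), of y 0] by (elim Ints_cases) simp
      moreover have "gap v x 0 \<le> 1" using v1 Pos_nonneg[OF 0(2)] by (simp add: gap_def)
      ultimately show ?thesis using v1 by simp
    qed
  qed
next
  case (Suc k)
  let ?w = "s (arm_node x (Suc k)) v"
  have "?w \<in> Pos" using Pos_reflect_arm Suc by simp
  moreover have "gap v x (Suc k) = gap ?w x k" "?w Branch = v Branch" "gap ?w y 0 = gap v y 0"
    using reflect_arm[of v k x] Suc Pos_in_root_space assms(3) by auto
  ultimately show ?case using Suc.IH[of ?w] Suc.prems by simp
qed

section \<open>Inequalities for orthogonal positive roots\<close>

text \<open>These partial scalar products in gap coordinates turn out to be the coefficients of the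
  canonical basis elements built from the roots \<open>\<theta>\<^sub>i\<close> (for \<open>k \<ge> 1\<close>) and from the paths through the
  branch vertex (for \<open>k = 0\<close>, the path avoiding the arm \<open>x\<close>).\<close>

definition tail :: "vect \<Rightarrow> vect \<Rightarrow> arm \<Rightarrow> nat \<Rightarrow> real" where
  "tail p q x k = (\<Sum>l=k..len x. gap p x l * gap q x l)"

lemma tail_commute: "tail p q x k = tail q p x k"
  by (simp add: tail_def mult.commute)

lemma tail_Suc: "k \<le> len x \<Longrightarrow> tail p q x k = gap p x k * gap q x k + tail p q x (Suc k)"
  by (simp add: tail_def sum.atLeast_Suc_atMost)

lemma value_eq_sum_gap:
  assumes "v \<in> Pos" "k \<le> len x"
  shows "v (arm_node x k) = (\<Sum>l=k..len x. gap v x l)"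
  using assms(2)
proof (induction rule: inc_induct)
  case base
  then show ?case using gap_last[OF assms(1)] by simp
next
  case (step k)
  then show ?case by (simp add: sum.atLeast_Suc_atMost[of k]) (simp add: gap_def)
qed

lemma sum_V:
  "(\<Sum>i\<in>V. f i) = f Branch + (\<Sum>k<a. f (Node ArmA (Suc k)))
     + (\<Sum>k<b. f (Node ArmB (Suc k))) + (\<Sum>k<c. f (Node ArmC (Suc k)))"
proof -
  let ?N = "\<lambda>x n. (\<lambda>k. Node x (Suc k)) ` {..<n}"
  have "V = insert Branch (?N ArmA a \<union> ?N ArmB b \<union> ?N ArmC c)"
  proof (rule Set.set_eqI)
    fix i
    show "i \<in> V \<longleftrightarrow> i \<in> insert Branch (?N ArmA a \<union> ?N ArmB b \<union> ?N ArmC c)"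
    proof (cases i)
      case (Node x k)
      then show ?thesis by (cases x; cases k) (auto simp: Node_in_V)
    qed (simp add: Branch_in_V)
  qed
  moreover have "sum f (?N x n) = (\<Sum>k<n. f (Node x (Suc k)))" for x n
    by (subst sum.reindex) (auto simp: inj_on_def)
  ultimately show ?thesis
    by (simp, subst sum.insert, simp, blast, subst sum.union_disjoint, simp_all, blast,
        subst sum.union_disjoint, auto simp: add.assoc)
qed

text \<open>Summation by parts; the boundary term at the outer end vanishes because \<open>p\<close> does beyond
  the arm.\<close>

lemma sum_by_parts_arm:
  assumes "p \<in> Pos"
  shows "(\<Sum>k<len x. p (arm_node x (Suc k)) * (gap q x (Suc k) - gap q x k)) =
    tail p q x 0 - p Branch * gap q x 0"
proof -
  have "(\<Sum>k<n. p (arm_node x (Suc k)) * (gap q x (Suc k) - gap q x k)) =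
    (\<Sum>l=0..n. gap p x l * gap q x l) + p (arm_node x (Suc n)) * gap q x n - p Branch * gap q x 0"
    for n
    by (induction n) (simp_all add: gap_def[of p] algebra_simps)
  from this[of "len x"] show ?thesis
    using Pos_root_space[OF assms, of "arm_node x (Suc (len x))"] by (simp add: tail_def Node_in_V)
qed

text \<open>In gap coordinates the bilinear form is diagonal: positive on the gaps, negative on the
  branch coordinate.\<close>

lemma form_eq_tails:
  assumes "p \<in> Pos" "q \<in> Pos" "x \<noteq> y" "x \<noteq> z" "y \<noteq> z"
  shows "form p q = tail p q x 0 + tail p q y 0 + tail p q z 0 - p Branch * q Branch"
proof -
  have q: "q \<in> root_space a b c" using Pos_in_root_space assms by blast
  have Branch: "form (simple_root Branch) q =
      gap q ArmA 0 + gap q ArmB 0 + gap q ArmC 0 - q Branch"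
    using form_simple_Branch_gap[OF q, of ArmA ArmB ArmC] by simp
  have "form p q = (\<Sum>i\<in>V. p i * form (simple_root i) q)"
    unfolding bform_def[of _ _ _ p]
    by (intro sum.cong) (auto simp: bform_simple_root sum_distrib_left mult.assoc)
  also have "\<dots> = p Branch * form (simple_root Branch) q
     + (\<Sum>k<len ArmA. p (arm_node ArmA (Suc k)) * (gap q ArmA (Suc k) - gap q ArmA k))
     + (\<Sum>k<len ArmB. p (arm_node ArmB (Suc k)) * (gap q ArmB (Suc k) - gap q ArmB k))
     + (\<Sum>k<len ArmC. p (arm_node ArmC (Suc k)) * (gap q ArmC (Suc k) - gap q ArmC k))"
    using form_simple_arm[OF q, of _ ArmA] form_simple_arm[OF q, of _ ArmB]
      form_simple_arm[OF q, of _ ArmC]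
    by (simp add: sum_V)
  also have "\<dots> = tail p q ArmA 0 + tail p q ArmB 0 + tail p q ArmC 0 - p Branch * q Branch"
    unfolding sum_by_parts_arm[OF assms(1)] Branch by (simp add: algebra_simps)
  finally show ?thesis using assms(3-) by (cases x; cases y; cases z) simp_all
qed

lemma gap_le_value:
  assumes "v \<in> Pos" "0 < v Branch" "k \<le> l" "l \<le> len x"
  shows "gap v x l \<le> v (arm_node x k)"
  using assms gap_nonneg[OF assms(1,2)]
  by (simp add: value_eq_sum_gap) (intro member_le_sum, auto)

lemma two_gaps_le_value:
  assumes "v \<in> Pos" "0 < v Branch" "k \<le> j" "j < i" "i \<le> len x"
  shows "gap v x i + gap v x j \<le> v (arm_node x k)"
proof -
  have "(\<Sum>l\<in>{i, j}. gap v x l) \<le> (\<Sum>l=k..len x. gap v x l)"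
    using assms gap_nonneg[OF assms(1,2)] by (intro sum_mono2) auto
  then show ?thesis using assms by (simp add: value_eq_sum_gap)
qed

lemma value_mono:
  assumes "v \<in> Pos" "0 < v Branch" "k \<le> l" "l \<le> len x"
  shows "v (arm_node x l) \<le> v (arm_node x k)"
  using assms gap_nonneg[OF assms(1,2)]
  by (simp add: value_eq_sum_gap) (intro sum_mono2, auto)

lemma tail_arm_root:
  assumes "j < i" "i \<le> len x"
  shows "tail (arm_root x j i) q y k =
    of_bool (y = x) * (of_bool (k \<le> i) * gap q x i - of_bool (k \<le> j) * gap q x j)"
proof (cases "y = x")
  case True
  have "gap (arm_root x j i) x l * gap q x l =
      (if l = i then gap q x i else 0) - (if l = j then gap q x j else 0)" for l
    using assms by (simp add: gap_arm_root)
  then show ?thesis using True assms by (simp add: tail_def sum_subtractf)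
next
  case False
  then show ?thesis using assms by (simp add: tail_def gap_arm_root)
qed

lemma form_commute: "form p q = form q p"
  unfolding bform_def by (subst sum.swap) (simp add: cartan_sym mult.commute mult.left_commute)

text \<open>The inequalities below are symmetric in the two roots, so two situations remain: both roots
  involve the branch vertex, or one of them is a root of an arm. In the latter case orthogonality
  says that the other root has the same gap \<open>g\<close> at both end positions of the arm root, and then the
  tails of the pair are \<open>g\<close> times the coordinates of the arm root.\<close>

lemma orthogonal_pair_induct [consumes 3, case_names symmetric generic arm]:
  assumes "p \<in> Pos" "q \<in> Pos" "form p q = 0"
    and sym: "\<And>p q. Q q p \<Longrightarrow> Q p q"
    and generic: "\<And>p q. p \<in> Pos \<Longrightarrow> q \<in> Pos \<Longrightarrow> form p q = 0 \<Longrightarrow>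
      0 < p Branch \<Longrightarrow> 0 < q Branch \<Longrightarrow> Q p q"
    and arm: "\<And>q x j i g. q \<in> Pos \<Longrightarrow> arm_root x j i \<in> Pos \<Longrightarrow> j < i \<Longrightarrow> i \<le> len x \<Longrightarrow>
      gap q x i = g \<Longrightarrow> gap q x j = g \<Longrightarrow> g = 0 \<or> 1 \<le> g \<and> 0 < q Branch \<Longrightarrow>
      (\<And>y k. tail (arm_root x j i) q y k = arm_root x j i (arm_node y k) * g) \<Longrightarrow>
      Q (arm_root x j i) q"
  shows "Q p q"
proof -
  have arm': "Q p q" if p: "p \<in> Pos" "p Branch = 0" and q: "q \<in> Pos" and o: "form p q = 0" for p q
  proof -
    obtain x j i where x: "j < i" "i \<le> len x" "p = arm_root x j i"
      using Pos_Branch_zero p by blast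
    obtain y z where yz: "x \<noteq> y" "x \<noteq> z" "y \<noteq> z"
      by (metis third_arm)
    have ij: "gap q x i = gap q x j"
      using form_eq_tails[OF p(1) q yz] x o p(2) yz by (simp add: tail_arm_root)
    have g: "gap q x i = 0 \<or> 1 \<le> gap q x i \<and> 0 < q Branch"
    proof (cases "q Branch = 0")
      case True
      then obtain t n m where "n < m" "q = arm_root t n m" using Pos_Branch_zero q by blast
      then show ?thesis using ij x(1) by (auto simp: gap_arm_root of_bool_def split: if_splits)
    next
      case False
      then have "0 < q Branch" using Pos_nonneg[OF q, of Branch] by simp
      moreover from this have "gap q x i \<ge> 0" using gap_nonneg q x by simp
      ultimately show ?thesis using gap_Ints[OF q, of x i] by (auto elim!: Ints_cases)
    qed
    have "tail (arm_root x j i) q y k = arm_root x j i (arm_node y k) * gap q x i" for y k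
      using x ij by (auto simp: tail_arm_root arm_root_arm_node)
    then show ?thesis using arm[OF q _ x(1,2) HOL.refl ij[symmetric] g] p(1) x(3) by simp
  qed
  show ?thesis
    using arm'[OF assms(1) _ assms(2,3)] arm'[OF assms(2) _ assms(1)] sym[of q p]
      generic[OF assms(1-3)] Pos_nonneg[OF assms(1), of Branch] Pos_nonneg[OF assms(2), of Branch]
      form_commute[of q p] assms(3)
    by (metis order_le_less)
qed

lemma tail_nonneg:
  assumes "p \<in> Pos" "q \<in> Pos" "form p q = 0"
  shows "0 \<le> tail p q x k"
  using assms
proof (induction p q rule: orthogonal_pair_induct)
  case (symmetric p q)
  then show ?case by (simp add: tail_commute)
next
  case (generic p q)
  then show ?case unfolding tail_def by (intro sum_nonneg mult_nonneg_nonneg gap_nonneg) auto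
next
  case (arm q y j i g)
  then show ?case by (auto simp: arm_root_arm_node)
qed

text \<open>If both roots involve the branch vertex, then each coordinate is the sum of the gaps from
  its position outwards. The product of two coordinates thus contains all products of such gaps, and
  the tail collects only those at equal positions.\<close>

lemma tail_le_product:
  assumes "p \<in> Pos" "q \<in> Pos" "form p q = 0" "k \<le> len x"
  shows "tail p q x k \<le> p (arm_node x k) * q (arm_node x k)"
  using assms(1-3)
proof (induction p q rule: orthogonal_pair_induct)
  case (symmetric p q)
  then show ?case by (simp add: tail_commute mult.commute)
next
  case (generic p q)
  have "tail p q x k \<le> (\<Sum>l=k..len x. gap p x l * q (arm_node x k))"
    unfolding tail_def using generic
    by (intro sum_mono mult_left_mono gap_le_value gap_nonneg) auto
  then show ?case using generic assms(4)
    by (simp add: value_eq_sum_gap[of p] sum_distrib_right)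
next
  case (arm q y j i g)
  then show ?case using Pos_nonneg[OF arm(1)] gap_le_value[OF arm(1), of k i y]
    by (auto simp: arm_root_arm_node)
qed

text \<open>For roots involving the branch vertex the coordinates decrease outwards, so this follows
  from \<open>tail_le_product\<close>. For an arm root \<open>arm_root y j i\<close> and \<open>l \<le> j\<close> the coordinate of the arm
  root at \<open>l\<close> is zero, but then both gaps equal to \<open>g\<close> contribute to the coordinate of \<open>q\<close> at \<open>l\<close>.\<close>

lemma tail_le_same_arm:
  assumes "p \<in> Pos" "q \<in> Pos" "form p q = 0" "l < k" "k \<le> len x"
  shows "2 * tail p q x k \<le>
    p (arm_node x k) * q (arm_node x l) + p (arm_node x l) * q (arm_node x k)"
  using assms(1-3)
proof (induction p q rule: orthogonal_pair_induct)
  case (symmetric p q)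
  then show ?case by (simp add: tail_commute mult.commute)
next
  case (generic p q)
  have "p (arm_node x k) * q (arm_node x k) \<le> p (arm_node x k) * q (arm_node x l)"
    using generic value_mono[of q l k x] Pos_nonneg assms by (intro mult_left_mono) auto
  moreover have "p (arm_node x k) * q (arm_node x k) \<le> p (arm_node x l) * q (arm_node x k)"
    using generic value_mono[of p l k x] Pos_nonneg assms by (intro mult_right_mono) auto
  ultimately show ?case using tail_le_product[OF generic(1-3) assms(5)] by linarith
next
  case (arm q y j i g)
  show ?case
  proof (cases "g \<noteq> 0 \<and> x = y \<and> j < k \<and> k \<le> i")
    case True
    then have q0: "0 < q Branch" using arm by auto
    show ?thesis
    proof (cases "j < l")
      case True2: True
      then show ?thesis using True arm assms(4) gap_le_value[OF arm(1) q0, of k i y]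
          gap_le_value[OF arm(1) q0, of l i y]
        by (auto simp: arm_root_arm_node)
    next
      case False
      then show ?thesis using True arm assms(4) two_gaps_le_value[OF arm(1) q0, of l j i y]
        by (auto simp: arm_root_arm_node)
    qed
  next
    case False
    then show ?thesis using arm Pos_nonneg[OF arm(1)] by (auto simp: arm_root_arm_node)
  qed
qed

text \<open>If \<open>g \<noteq> 0\<close>, then the two gaps equal to \<open>g\<close> force the branch coordinate of \<open>q\<close> to be at
  least \<open>2\<close>, so the exception in \<open>two_gaps_le_Branch\<close> does not arise.\<close>

lemma arm_root_tail_other_arm:
  assumes "q \<in> Pos" "j < i" "i \<le> len t" "gap q t i = g" "gap q t j = g"
    "g = 0 \<or> 1 \<le> g \<and> 0 < q Branch" "x \<noteq> y"
  shows "arm_root t j i (arm_node x k) * g \<le> arm_root t j i (arm_node x k) * q (Node y 1)"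
proof (cases "g \<noteq> 0 \<and> x = t")
  case True
  then have g: "1 \<le> g" and q0: "0 < q Branch" using assms(6) by auto
  have "2 * g \<le> q Branch" using two_gaps_le_value[OF assms(1) q0, of 0 j i t] assms by simp
  then have "g + gap q y 0 \<le> q Branch"
    using two_gaps_le_Branch[OF assms(1) q0, of t y i] assms True g by auto
  then show ?thesis by (intro mult_left_mono) (auto simp: gap_def arm_root_arm_node)
next
  case False
  then show ?thesis using Pos_nonneg[OF assms(1)] by (auto simp: arm_root_arm_node)
qed

text \<open>If \<open>q\<close> is not exceptional in the sense of \<open>two_gaps_le_Branch\<close>, then \<open>q (Node y 1)\<close>, which is
  \<open>q Branch - gap q y 0\<close>, bounds every gap of \<open>q\<close> on the arm \<open>x\<close> and the first product alone
  suffices; likewise for \<open>p\<close> and the second product. If both roots are exceptional, then the arm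
  \<open>y\<close> already contributes \<open>1 = p Branch * q Branch\<close> to the orthogonality relation, so nothing is left
  for the arm \<open>x\<close>.\<close>

lemma tail_le_cross_arm:
  assumes "p \<in> Pos" "q \<in> Pos" "form p q = 0" "x \<noteq> y" "k \<le> len x"
  shows "tail p q x k \<le> p (arm_node x k) * q (Node y 1) + p (Node y 1) * q (arm_node x k)"
  using assms(1-3)
proof (induction p q rule: orthogonal_pair_induct)
  case (symmetric p q)
  then show ?case by (simp add: tail_commute mult.commute add.commute)
next
  case (arm q t j i g)
  have "0 \<le> arm_root t j i (Node y 1) * q (arm_node x k)"
    using Pos_nonneg arm(1,2) by simp
  then show ?case
    using arm_root_tail_other_arm[OF arm(1,3-7) assms(4), of k] arm(8)[of x k] by linarith
next
  case (generic p q)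
  have rhs: "0 \<le> p (arm_node x k) * q (Node y 1)" "0 \<le> p (Node y 1) * q (arm_node x k)"
    using Pos_nonneg generic(1,2) by simp_all
  have bound: "tail v w x k \<le> v (arm_node x k) * w (Node y 1)"
    if "v \<in> Pos" "w \<in> Pos" "0 < v Branch" "0 < w Branch"
      "\<not> (w Branch = 1 \<and> gap w y 0 = 1)" for v w
  proof -
    have "gap w x l \<le> w (Node y 1)" if "l \<le> len x" for l
      using two_gaps_le_Branch[of w x y l] \<open>w \<in> Pos\<close> \<open>0 < w Branch\<close> assms(4) that
        \<open>\<not> (w Branch = 1 \<and> gap w y 0 = 1)\<close>
      by (auto simp: gap_def[of w y])
    then have "tail v w x k \<le> (\<Sum>l=k..len x. gap v x l * w (Node y 1))"
      unfolding tail_def using that by (intro sum_mono mult_left_mono gap_nonneg) auto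
    then show ?thesis using that assms(5) by (simp add: value_eq_sum_gap[of v] sum_distrib_right)
  qed
  show ?case
  proof (cases "(p Branch = 1 \<and> gap p y 0 = 1) \<and> (q Branch = 1 \<and> gap q y 0 = 1)")
    case True
    obtain z where z: "z \<noteq> x" "z \<noteq> y" using third_arm .
    have "tail p q x 0 + tail p q y 0 + tail p q z 0 = 1"
      using form_eq_tails[OF generic(1,2), of x y z] z assms(4) generic(3) True by simp
    moreover have "tail p q y 0 = 1 + tail p q y 1" using True tail_Suc[of 0 y] by simp
    moreover have "tail p q x k \<le> tail p q x 0"
      unfolding tail_def using generic by (intro sum_mono2 mult_nonneg_nonneg gap_nonneg) auto
    ultimately have "tail p q x k \<le> 0"
      using tail_nonneg[OF generic(1-3), of y 1] tail_nonneg[OF generic(1-3), of z 0] by linarith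
    then show ?thesis using rhs by linarith
  next
    case False
    then have "tail p q x k \<le> p (arm_node x k) * q (Node y 1) \<or>
        tail q p x k \<le> q (arm_node x k) * p (Node y 1)"
      using bound[of p q] bound[of q p] generic by blast
    then show ?thesis using rhs tail_commute[of q p] by (auto simp: mult.commute)
  qed
qed

text \<open>By the orthogonality relation, the difference of the two sides is the product of
  \<open>p Branch - gap p x 0 - gap p y 0\<close> and the same expression for \<open>q\<close>, plus the full tail on the third
  arm. If one of the two factors is negative, then that root is exceptional for both arms and
  vanishes at the neighbours of the branch vertex, so both tails are bounded by products that are
  zero.\<close>

lemma tails_le_Branch_neighbours:
  assumes "p \<in> Pos" "q \<in> Pos" "form p q = 0" "x \<noteq> y"
  shows "tail p q x 1 + tail p q y 1 \<le> p (Node x 1) * q (Node y 1) + p (Node y 1) * q (Node x 1)"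
  using assms(1-3)
proof (induction p q rule: orthogonal_pair_induct)
  case (symmetric p q)
  then show ?case by (simp add: tail_commute mult.commute add.commute)
next
  case (arm q t j i g)
  then show ?case
    using arm_root_tail_other_arm[OF arm(1,3-7) assms(4), of 1]
      arm_root_tail_other_arm[OF arm(1,3-7) assms(4)[symmetric], of 1] by simp
next
  case (generic p q)
  let ?m = "\<lambda>v. v Branch - gap v x 0 - gap v y 0"
  have small: "tail v w x 1 + tail v w y 1 \<le> 0"
    if v: "v \<in> Pos" "0 < v Branch" "?m v < 0" and w: "w \<in> Pos" "form v w = 0" for v w
  proof -
    have "v Branch = 1" "gap v y 0 = 1"
      using two_gaps_le_Branch[OF v(1,2) assms(4), of 0] v(3) by auto
    moreover have "v Branch = 1" "gap v x 0 = 1"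
      using two_gaps_le_Branch[OF v(1,2) assms(4)[symmetric], of 0] v(3) by auto
    ultimately have "v (Node x 1) = 0" "v (Node y 1) = 0" by (simp_all add: gap_def)
    then show ?thesis
      using tail_le_product[OF v(1) w, of 1 x] tail_le_product[OF v(1) w, of 1 y] len_pos by simp
  qed
  have rhs: "0 \<le> p (Node x 1) * q (Node y 1) + p (Node y 1) * q (Node x 1)"
    using Pos_nonneg generic(1,2) by simp
  consider "?m p < 0" | "?m q < 0" | "?m p \<ge> 0" "?m q \<ge> 0" by linarith
  then show ?case
  proof cases
    case 1
    then show ?thesis using small generic rhs by fastforce
  next
    case 2
    have "form q p = 0" using generic form_commute by simp
    then show ?thesis using small[of q p] 2 generic rhs tail_commute[of p q] by fastforce
  next
    case 3
    obtain z where z: "z \<noteq> x" "z \<noteq> y" using third_arm .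
    have "tail p q x 0 + tail p q y 0 + tail p q z 0 = p Branch * q Branch"
      using form_eq_tails[OF generic(1,2), of x y z] z assms(4) generic(3) by simp
    moreover have "tail p q x 0 = gap p x 0 * gap q x 0 + tail p q x 1"
      "tail p q y 0 = gap p y 0 * gap q y 0 + tail p q y 1"
      using tail_Suc[of 0] by simp_all
    ultimately have tails: "tail p q x 1 + tail p q y 1 = p Branch * q Branch
        - gap p x 0 * gap q x 0 - gap p y 0 * gap q y 0 - tail p q z 0"
      by linarith
    have first: "v (Node r 1) = v Branch - gap v r 0" for v r by (simp add: gap_def)
    have "p (Node x 1) * q (Node y 1) + p (Node y 1) * q (Node x 1)
        - (tail p q x 1 + tail p q y 1) = ?m p * ?m q + tail p q z 0"
      unfolding tails first by (simp add: algebra_simps)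
    moreover have "0 \<le> ?m p * ?m q" using 3 by simp
    ultimately show ?thesis using tail_nonneg[OF generic(1-3), of z 0] by linarith
  qed
qed

section \<open>Expansion in the canonical basis\<close>

definition integral_cone :: "tensor set" where
  "integral_cone = {\<xi>. \<exists>m :: tensor \<Rightarrow> int. (\<forall>x. m x \<ge> 0) \<and>
    (\<forall>i j. \<xi> i j = (\<Sum>x\<in>canonical_basis a b c. real_of_int (m x) * x i j))}"

lemma integral_cone_zero: "(\<lambda>i j. 0) \<in> integral_cone"
  unfolding integral_cone_def by (auto intro!: exI[of _ "\<lambda>_. 0"])

lemma integral_cone_add:
  assumes "f \<in> integral_cone" "g \<in> integral_cone"
  shows "(\<lambda>i j. f i j + g i j) \<in> integral_cone"
proof -
  obtain m n :: "tensor \<Rightarrow> int" where "\<forall>x. m x \<ge> 0" "\<forall>x. n x \<ge> 0"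
    "\<And>i j. f i j = (\<Sum>x\<in>canonical_basis a b c. real_of_int (m x) * x i j)"
    "\<And>i j. g i j = (\<Sum>x\<in>canonical_basis a b c. real_of_int (n x) * x i j)"
    using assms unfolding integral_cone_def by blast
  then show ?thesis unfolding integral_cone_def
    by (auto intro!: exI[of _ "\<lambda>x. m x + n x"] simp: distrib_right sum.distrib)
qed

lemma integral_cone_sum:
  assumes "finite S" "\<And>u. u \<in> S \<Longrightarrow> F u \<in> integral_cone"
  shows "(\<lambda>i j. \<Sum>u\<in>S. F u i j) \<in> integral_cone"
  using assms
proof (induction S rule: finite_induct)
  case empty
  then show ?case using integral_cone_zero by simp
next
  case (insert u S)
  then show ?case using integral_cone_add[of "F u" "\<lambda>i j. \<Sum>u\<in>S. F u i j"] by simp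
qed

lemma integral_cone_multiple:
  assumes "x \<in> canonical_basis a b c" "r \<in> \<int>" "0 \<le> r"
  shows "(\<lambda>i j. r * x i j) \<in> integral_cone"
proof -
  obtain n where n: "r = of_int n" "0 \<le> n" using assms(2,3) by (auto elim: Ints_cases)
  have "r * x i j = (\<Sum>y\<in>canonical_basis a b c. of_int (if y = x then n else 0) * y i j)" for i j
    using assms(1) finite_canonical_basis n
    by (simp add: if_distrib[of real_of_int] if_distrib[of "\<lambda>t. t * _"] cong: if_cong)
  then show ?thesis unfolding integral_cone_def using n
    by (auto intro!: exI[of _ "\<lambda>y. if y = x then n else 0"])
qed

lemma vee_simple_add:
  assumes "vee (simple_root u) \<phi> \<in> integral_cone" "vee (simple_root u) \<psi> \<in> integral_cone"
  shows "vee (simple_root u) (\<lambda>v. \<phi> v + \<psi> v) \<in> integral_cone"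
proof -
  have "vee (simple_root u) (\<lambda>v. \<phi> v + \<psi> v) =
      (\<lambda>i j. vee (simple_root u) \<phi> i j + vee (simple_root u) \<psi> i j)"
    by (simp add: vee_def tprod_def algebra_simps)
  then show ?thesis using integral_cone_add[OF assms] by simp
qed

lemma vee_simple_sum:
  assumes "finite S" "\<And>w. w \<in> S \<Longrightarrow> vee (simple_root u) (F w) \<in> integral_cone"
  shows "vee (simple_root u) (\<lambda>v. \<Sum>w\<in>S. F w v) \<in> integral_cone"
proof -
  have "vee (simple_root u) (\<lambda>v. \<Sum>w\<in>S. F w v) = (\<lambda>i j. \<Sum>w\<in>S. vee (simple_root u) (F w) i j)"
    by (simp add: vee_def tprod_def sum.distrib sum_distrib_left sum_distrib_right)
  then show ?thesis using integral_cone_sum[OF assms] by simp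
qed

lemma vee_simple_elementary_multiple:
  assumes "u \<in> V" "elementary a b c u \<beta>" "r \<in> \<int>" "0 \<le> r"
  shows "vee (simple_root u) (\<lambda>v. r * \<beta> v) \<in> integral_cone"
proof -
  have "vee (simple_root u) \<beta> \<in> canonical_basis a b c"
    using assms unfolding canonical_basis_def by blast
  moreover have "vee (simple_root u) (\<lambda>v. r * \<beta> v) = (\<lambda>i j. r * vee (simple_root u) \<beta> i j)"
    by (simp add: vee_def tprod_def algebra_simps)
  ultimately show ?thesis using integral_cone_multiple assms(3,4) by simp
qed

lemma Pos_add_simple:
  assumes "v \<in> Pos" "i \<in> V" "form (simple_root i) v = -1"
  shows "(\<lambda>j. v j + simple_root i j) \<in> Pos"
  using Pos_raise[OF assms(1,2)] assms(3) by (simp add: reflect_def)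

lemma elementary_simple_root:
  "j \<in> V \<Longrightarrow> cartan i j = 0 \<Longrightarrow> elementary a b c i (simple_root j)"
  unfolding elementary_def using Pos_positive_root Pos_simple by blast

lemma path_Pos:
  assumes "h \<in> V" "i \<in> V" "j \<in> V" "h \<noteq> j" "adjacent h i" "adjacent i j"
  shows "(\<lambda>k. simple_root h k + simple_root i k + simple_root j k) \<in> Pos"
proof -
  have c: "cartan j i = -1" "cartan h i = -1" "cartan h j = 0"
    using assms by (cases h; cases i; cases j; auto simp: cartan_def Node_in_V)+
  have ji: "form (simple_root j) (simple_root i) = -1"
    using c assms bform_simple_simple by simp
  have sji: "s j (simple_root i) = (\<lambda>k. simple_root i k + simple_root j k)"
    using ji by (simp add: reflect_def)
  then have ij: "(\<lambda>k. simple_root i k + simple_root j k) \<in> Pos"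
    using Pos_raise[OF Pos_simple[OF assms(2)] assms(3)] ji by simp
  have "form (simple_root h) (s j (simple_root i)) = -1"
    using bform_simple_reflect[OF assms(3,1), of "simple_root i"] c assms bform_simple_simple by simp
  from Pos_add_simple[OF ij assms(1)] this sji show ?thesis by (simp add: add_ac)
qed

lemma elementary_path:
  assumes "h \<in> V" "i \<in> V" "j \<in> V" "h \<noteq> j" "adjacent h i" "adjacent i j"
  shows "elementary a b c i (\<lambda>k. simple_root h k + simple_root i k + simple_root j k)"
  unfolding elementary_def using path_Pos[OF assms] Pos_positive_root assms by blast

text \<open>The highest root \<open>\<theta>\<^sub>i\<close> of the subsystem of type \<open>D\<close> for the vertex \<open>i = Node x k\<close>; an
  explicit formula spares counting neighbours later on.\<close>

definition theta :: "arm \<Rightarrow> nat \<Rightarrow> vect" where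
  "theta x k v = (case v of Branch \<Rightarrow> 2 | Node y l \<Rightarrow>
    if y \<noteq> x then of_bool (l = 1) else if l = k then 1 else if 1 \<le> l \<and> l < k then 2 else 0)"

lemma d_highest_root_eq_theta:
  assumes "1 \<le> k" "k \<le> len x"
  shows "d_highest_root (d_support a b c (Node x k)) = theta x k"
proof
  fix j
  let ?S = "d_support a b c (Node x k)"
  let ?N = "{u \<in> ?S. adjacent j u}"
  have S_Branch: "Branch \<in> ?S" by (simp add: d_support_def)
  have S_Node: "Node y l \<in> ?S \<longleftrightarrow> l = 1 \<or> y = x \<and> 1 \<le> l \<and> l \<le> k" for y l
    using len_pos[of y] by (auto simp: d_support_def Node_in_V)
  show "d_highest_root ?S j = theta x k j"
  proof (cases j)
    case Branch
    have "?N = {Node ArmA 1, Node ArmB 1, Node ArmC 1}"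
    proof (rule Set.set_eqI)
      fix u
      show "u \<in> ?N \<longleftrightarrow> u \<in> {Node ArmA 1, Node ArmB 1, Node ArmC 1}"
      proof (cases u)
        case (Node y l)
        then show ?thesis using Branch S_Node by (cases y) auto
      qed (use Branch in auto)
    qed
    then show ?thesis using Branch S_Branch by (simp add: d_highest_root_def theta_def)
  next
    case (Node y l)
    show ?thesis
    proof (cases "Node y l \<in> ?S")
      case False
      then show ?thesis using Node S_Node assms by (auto simp: d_highest_root_def theta_def)
    next
      case True
      then obtain l' where l: "l = Suc l'" using S_Node by (cases l) auto
      have N: "u \<in> ?N \<longleftrightarrow> u = arm_node y l' \<or> y = x \<and> l < k \<and> u = Node x (Suc l)" for u
        using True assms unfolding Node l
        by (cases u; cases l') (auto simp: S_Branch S_Node)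
      show ?thesis
      proof (cases "y = x \<and> l < k")
        case True2: True
        then have "?N = {arm_node x l', Node x (Suc l)}" using N by auto
        then have "card ?N = 2" using l by (cases l') auto
        then show ?thesis using True True2 Node l by (simp add: d_highest_root_def theta_def)
      next
        case False
        then have "?N = {arm_node y l'}" using N by auto
        then show ?thesis using True False Node l S_Node assms
          by (auto simp: d_highest_root_def theta_def)
      qed
    qed
  qed
qed

text \<open>The highest root of the \<open>D\<^sub>4\<close> around the branch vertex is reached by adding the three
  neighbours to the branch vertex and then the branch vertex once more. Adding the simple roots at
  distances \<open>k + 1\<close> and \<open>k\<close>, in this order, leads from one \<open>\<theta>\<close> to the next.\<close>

lemma theta_Pos:
  assumes "1 \<le> k" "k \<le> len x"
  shows "theta x k \<in> Pos"
  using assms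
proof (induction k rule: dec_induct)
  case base
  let ?AB = "\<lambda>u. simple_root (Node ArmA 1) u + simple_root Branch u + simple_root (Node ArmB 1) u"
  let ?ABC = "\<lambda>u. ?AB u + simple_root (Node ArmC 1) u"
  have N1: "Node y (Suc 0) \<in> V" for y using len_pos by (simp add: Node_in_V)
  have AB: "?AB \<in> Pos" using N1 Branch_in_V by (intro path_Pos) auto
  have "form (simple_root (arm_node ArmC (Suc 0))) ?AB = -1"
    using form_simple_arm[OF Pos_in_root_space[OF AB], of 0 ArmC] len_pos[of ArmC]
    by (simp add: gap_def simple_root_def)
  then have ABC: "?ABC \<in> Pos" using Pos_add_simple[OF AB, of "Node ArmC 1"] N1 by simp
  have "form (simple_root Branch) ?ABC = -1"
    by (subst form_simple_Branch[OF Pos_in_root_space[OF ABC]]) (simp add: simple_root_def)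
  then have "(\<lambda>u. ?ABC u + simple_root Branch u) \<in> Pos"
    using Pos_add_simple[OF ABC Branch_in_V] by simp
  moreover have "(\<lambda>u. ?ABC u + simple_root Branch u) = theta x 1"
  proof
    fix u show "?ABC u + simple_root Branch u = theta x 1 u"
    proof (cases u)
      case (Node y l)
      then show ?thesis by (cases y) (auto simp: simple_root_def theta_def)
    qed (simp add: simple_root_def theta_def)
  qed
  ultimately show ?case by simp
next
  case (step k)
  then obtain k' where k: "k = Suc k'" by (cases k) auto
  have th: "theta x k \<in> Pos" and kl: "k < len x" using step by auto
  let ?w = "\<lambda>u. theta x k u + simple_root (arm_node x (Suc k)) u"
  have "form (simple_root (arm_node x (Suc k))) (theta x k) = -1"
    using form_simple_arm[OF Pos_in_root_space[OF th], of k x] kl k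
    by (simp add: gap_def theta_def)
  then have w: "?w \<in> Pos" using Pos_add_simple[OF th] kl by (simp add: Node_in_V)
  have "form (simple_root (arm_node x (Suc k'))) ?w = -1"
    using form_simple_arm[OF Pos_in_root_space[OF w], of k' x] kl k
    by (cases k') (simp_all add: gap_def theta_def simple_root_def)
  then have "(\<lambda>u. ?w u + simple_root (arm_node x (Suc k')) u) \<in> Pos"
    using Pos_add_simple[OF w] kl k by (simp add: Node_in_V)
  moreover have "(\<lambda>u. ?w u + simple_root (arm_node x (Suc k')) u) = theta x (Suc k)"
    by (rule ext) (auto simp: theta_def simple_root_def k split: node.split)
  ultimately show ?case by simp
qed

lemma elementary_theta:
  assumes "1 \<le> k" "k \<le> len x"
  shows "elementary a b c (Node x k) (theta x k)"
  unfolding elementary_def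
  using theta_Pos[OF assms] Pos_positive_root d_highest_root_eq_theta[OF assms] by auto

lemma arm_node_eq_Node:
  "arm_node x k = Node y l \<longleftrightarrow> x = y \<and> k = l \<and> 0 < l"
  "Node y l = arm_node x k \<longleftrightarrow> x = y \<and> k = l \<and> 0 < l"
  by (cases k; auto)+

lemma arm_node_eq_Branch:
  "arm_node x k = Branch \<longleftrightarrow> k = 0"
  "Branch = arm_node x k \<longleftrightarrow> k = 0"
  by (cases k; auto)+

definition arm_path :: "arm \<Rightarrow> nat \<Rightarrow> vect" where
  "arm_path x k = (\<lambda>v. simple_root (arm_node x (k - 1)) v + simple_root (arm_node x k) v
     + simple_root (arm_node x (Suc k)) v)"

lemma elementary_arm_path:
  assumes "1 \<le> k" "k < len x"
  shows "elementary a b c (Node x k) (arm_path x k)"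
proof -
  obtain k' where k: "k = Suc k'" using assms by (cases k) auto
  have "elementary a b c (arm_node x (Suc k')) (arm_path x k)"
    unfolding arm_path_def k using assms k
    by (simp only: diff_Suc_1, intro elementary_path)
      (cases k'; simp add: arm_node_in_V Node_in_V Branch_in_V)+
  then show ?thesis by (simp add: k)
qed

text \<open>The vectors \<open>\<phi>\<^sub>u = near_part p q u\<close> are chosen such that \<open>\<Sum>\<^sub>u \<alpha>\<^sub>u \<or> \<phi>\<^sub>u\<close> agrees with
  \<open>p \<or> q\<close> in all diagonal entries and in all entries belonging to edges. Only paths and the roots
  \<open>\<theta>\<close> affect these entries, and solving for their coefficients from the outer end of each arm
  inwards determines them as below. At the branch vertex the orthogonality relation turns
  \<open>p Branch * q Branch - tail p q y 0\<close> into the sum of the tails of the other two arms, which makes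
  \<open>\<phi>\<close> a combination of the three paths.\<close>

definition near_part :: "vect \<Rightarrow> vect \<Rightarrow> node \<Rightarrow> vect" where
  "near_part p q u v = (case u of
     Branch \<Rightarrow> (case v of Branch \<Rightarrow> p Branch * q Branch
       | Node y l \<Rightarrow> of_bool (l = 1) * (p Branch * q Branch - tail p q y 0))
   | Node x k \<Rightarrow> (p u * q u - tail p q x k) * arm_path x k v + tail p q x k * theta x k v)"

lemma tail_Ints: "p \<in> Pos \<Longrightarrow> q \<in> Pos \<Longrightarrow> tail p q x k \<in> \<int>"
  unfolding tail_def by (intro Ints_sum Ints_mult gap_Ints)

lemma tail_last:
  assumes "p \<in> Pos" "q \<in> Pos"
  shows "tail p q x (len x) = p (Node x (len x)) * q (Node x (len x))"
proof -
  have "arm_node x (len x) = Node x (len x)" using len_pos[of x] by (cases "len x") auto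
  then show ?thesis using assms by (simp add: tail_def gap_last)
qed

lemma near_part_Ints:
  assumes "p \<in> Pos" "q \<in> Pos"
  shows "near_part p q u v \<in> \<int>"
proof -
  have "arm_path x k v \<in> \<int>" "theta x k v \<in> \<int>" for x k
    by (auto simp: arm_path_def simple_root_def theta_def split: node.split)
  then show ?thesis unfolding near_part_def using Pos_Ints assms tail_Ints
    by (auto split: node.split intro!: Ints_mult Ints_add Ints_diff)
qed

text \<open>The coefficients of the paths are nonnegative by \<open>tail_le_product\<close>. At the outer end of an
  arm there is no path, but there the coefficient is zero.\<close>

lemma near_part_in_integral_cone:
  assumes "p \<in> Pos" "q \<in> Pos" "form p q = 0" "u \<in> V"
  shows "vee (simple_root u) (near_part p q u) \<in> integral_cone"
proof (cases u)
  case Branch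
  let ?r = "\<lambda>x y v. simple_root (Node x 1) v + simple_root Branch v + simple_root (Node y 1) v"
  have el: "vee (simple_root Branch) (\<lambda>v. tail p q z 0 * ?r x y v) \<in> integral_cone"
    if "x \<noteq> y" for x y z
    using len_pos that tail_Ints tail_nonneg assms
    by (intro vee_simple_elementary_multiple elementary_path) (auto simp: Node_in_V Branch_in_V)
  have "near_part p q Branch = (\<lambda>v. tail p q ArmA 0 * ?r ArmB ArmC v +
      (tail p q ArmB 0 * ?r ArmA ArmC v + tail p q ArmC 0 * ?r ArmA ArmB v))"
  proof
    fix v
    have o: "p Branch * q Branch = tail p q ArmA 0 + tail p q ArmB 0 + tail p q ArmC 0"
      using form_eq_tails[OF assms(1,2), of ArmA ArmB ArmC] assms(3) by simp
    show "near_part p q Branch v = tail p q ArmA 0 * ?r ArmB ArmC v +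
      (tail p q ArmB 0 * ?r ArmA ArmC v + tail p q ArmC 0 * ?r ArmA ArmB v)"
    proof (cases v)
      case (Node y l)
      then show ?thesis by (cases y) (auto simp: near_part_def simple_root_def o)
    qed (simp add: near_part_def simple_root_def o)
  qed
  then show ?thesis unfolding Branch by (simp only:) (intro vee_simple_add el; simp)
next
  case (Node x k)
  then have k: "1 \<le> k" "k \<le> len x" using assms(4) by (auto simp: Node_in_V)
  have kn: "arm_node x k = Node x k" using k by (cases k) auto
  have th: "vee (simple_root u) (\<lambda>v. tail p q x k * theta x k v) \<in> integral_cone"
    unfolding Node using k assms tail_Ints tail_nonneg
    by (intro vee_simple_elementary_multiple elementary_theta) (auto simp: Node_in_V)
  have pa: "vee (simple_root u) (\<lambda>v. (p u * q u - tail p q x k) * arm_path x k v) \<in> integral_cone"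
  proof (cases "k = len x")
    case True
    then have "p u * q u - tail p q x k = 0" using tail_last assms Node by simp
    then show ?thesis using integral_cone_zero by (simp add: vee_def tprod_def)
  next
    case False
    then show ?thesis unfolding Node
      using k assms tail_Ints Pos_Ints tail_le_product[OF assms(1-3) k(2)] kn
      by (intro vee_simple_elementary_multiple elementary_arm_path Ints_diff Ints_mult)
        (auto simp: Node_in_V)
  qed
  have "near_part p q u =
      (\<lambda>v. (p u * q u - tail p q x k) * arm_path x k v + tail p q x k * theta x k v)"
    by (rule ext) (simp add: near_part_def Node)
  then show ?thesis using vee_simple_add[OF pa th] by simp
qed

lemma near_part_outside:
  assumes "p \<in> Pos" "q \<in> Pos" "u \<in> V" "v \<notin> V"
  shows "near_part p q u v = 0"
proof (cases u)
  case Branch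
  then show ?thesis using assms(4) len_pos
    by (cases v) (auto simp: near_part_def Node_in_V Branch_in_V)
next
  case (Node x k)
  then have k: "1 \<le> k" "k \<le> len x" using assms(3) by (auto simp: Node_in_V)
  have th: "theta x k v = 0"
    using assms(4) k len_pos by (cases v) (auto simp: theta_def Node_in_V Branch_in_V)
  have "arm_path x k v = 0" if "k \<noteq> len x"
  proof -
    have "v \<noteq> arm_node x (k - 1)" "v \<noteq> arm_node x k" "v \<noteq> arm_node x (Suc k)"
      using assms(4) k that arm_node_in_V by (auto simp del: arm_node.simps)
    then show ?thesis by (simp add: arm_path_def simple_root_def)
  qed
  then show ?thesis using th tail_last assms Node by (cases "k = len x") (auto simp: near_part_def)
qed

lemma near_part_diagonal: "u \<in> V \<Longrightarrow> near_part p q u u = p u * q u"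
  by (cases u)
    (auto simp: near_part_def arm_path_def theta_def simple_root_def Node_in_V arm_node_eq_Node)

lemma near_part_edge:
  assumes "Suc k \<le> len x"
  shows "near_part p q (arm_node x k) (Node x (Suc k))
      + near_part p q (Node x (Suc k)) (arm_node x k) =
    p (arm_node x k) * q (Node x (Suc k)) + p (Node x (Suc k)) * q (arm_node x k)"
  using tail_Suc[of k x p q] assms
  by (cases k)
    (simp_all add: near_part_def arm_path_def theta_def simple_root_def gap_def
      arm_node_eq_Node algebra_simps)

lemma adjacent_in_V:
  assumes "u \<in> V" "v \<in> V" "adjacent u v"
  obtains x k where "Suc k \<le> len x"
    "u = arm_node x k \<and> v = Node x (Suc k) \<or> v = arm_node x k \<and> u = Node x (Suc k)"
proof (cases u)
  case u: Branch
  then obtain x where "v = Node x 1" using assms(3) by (cases v) auto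
  then show ?thesis using u that[of 0 x] assms(2) by (simp add: Node_in_V)
next
  case u: (Node x k)
  show ?thesis
  proof (cases v)
    case Branch
    then show ?thesis using u that[of 0 x] assms by (simp add: Node_in_V)
  next
    case v: (Node y l)
    then have "x = y" "l = Suc k \<or> k = Suc l" using u assms(3) by auto
    then show ?thesis
      using u v that[of k x] that[of l x] assms(1,2) by (auto simp: Node_in_V arm_node_eq_Node)
  qed
qed

lemma near_part_adjacent:
  assumes "u \<in> V" "v \<in> V" "cartan u v \<noteq> 0"
  shows "near_part p q u v + near_part p q v u = p u * q v + p v * q u"
proof (cases "u = v")
  case True
  then show ?thesis using near_part_diagonal assms by simp
next
  case False
  then have "adjacent u v" using assms(3) by (auto simp: cartan_def split: if_splits)
  then obtain x k where "Suc k \<le> len x"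
    "u = arm_node x k \<and> v = Node x (Suc k) \<or> v = arm_node x k \<and> u = Node x (Suc k)"
    using adjacent_in_V assms(1,2) by blast
  then show ?thesis using near_part_edge[of k x p q]
    by (elim disjE conjE) (simp_all add: add.commute)
qed

text \<open>The elements \<open>\<alpha>\<^sub>u \<or> \<alpha>\<^sub>v\<close> with \<open>u\<close>, \<open>v\<close> not adjacent have to supply what is missing, and
  the missing amount is nonnegative. Beyond nonnegativity of coordinates, this is where the three
  inequalities between tails and products at different vertices enter.\<close>

lemma near_part_nonadjacent:
  assumes "p \<in> Pos" "q \<in> Pos" "form p q = 0" "u \<in> V" "v \<in> V" "cartan u v = 0"
  shows "near_part p q u v + near_part p q v u \<le> p u * q v + p v * q u"
proof -
  have nn: "0 \<le> p i * q j" for i j using Pos_nonneg assms(1,2) by simp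
  have same: "near_part p q (arm_node x l) (Node x k) + near_part p q (Node x k) (arm_node x l)
      \<le> p (arm_node x l) * q (Node x k) + p (Node x k) * q (arm_node x l)"
    if "Suc l < k" "k \<le> len x" for x k l
  proof -
    have "near_part p q (arm_node x l) (Node x k) = 0"
      using that by (cases l)
        (auto simp: near_part_def arm_path_def theta_def simple_root_def arm_node_eq_Node)
    moreover have "near_part p q (Node x k) (arm_node x l) = 2 * tail p q x k"
      using that by (cases l)
        (auto simp: near_part_def arm_path_def theta_def simple_root_def
          arm_node_eq_Node arm_node_eq_Branch)
    moreover have "arm_node x k = Node x k" using that by (simp add: arm_node_eq_Node)
    ultimately show ?thesis using tail_le_same_arm[OF assms(1-3), of l k x] that by simp
  qed
  have cross: "near_part p q (Node x k) (Node y l) + near_part p q (Node y l) (Node x k)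
      \<le> p (Node x k) * q (Node y l) + p (Node y l) * q (Node x k)"
    if "x \<noteq> y" "1 \<le> k" "k \<le> len x" "1 \<le> l" "l \<le> len y" for x k y l
  proof -
    have off_arm: "near_part p q (Node x k) (Node y l) = of_bool (l = 1) * tail p q x k"
      if "x \<noteq> y" "1 \<le> k" "1 \<le> l" for x k y l
      using that by (auto simp: near_part_def arm_path_def theta_def simple_root_def arm_node_eq_Node)
    have node: "arm_node x k = Node x k" "arm_node y l = Node y l"
      using that by (simp_all add: arm_node_eq_Node)
    have "of_bool (l = 1) * tail p q x k + of_bool (k = 1) * tail p q y l
        \<le> p (Node x k) * q (Node y l) + p (Node y l) * q (Node x k)"
      using tails_le_Branch_neighbours[OF assms(1-3) that(1)]
        tail_le_cross_arm[OF assms(1-3) that(1,3)]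
        tail_le_cross_arm[OF assms(1-3) that(1)[symmetric] that(5)]
        nn[of "Node x k" "Node y l"] nn[of "Node y l" "Node x k"] node
      by (cases "l = 1"; cases "k = 1") (simp_all add: add.commute)
    then show ?thesis using off_arm[of x y k l] off_arm[of y x l k] that by simp
  qed
  show ?thesis
  proof (cases u)
    case u: Branch
    show ?thesis
    proof (cases v)
      case (Node x k)
      then show ?thesis using u assms same[of 0 k x]
        by (auto simp: cartan_def Node_in_V split: if_splits)
    qed (use u assms in \<open>simp add: cartan_def\<close>)
  next
    case u: (Node x k)
    show ?thesis
    proof (cases v)
      case Branch
      then show ?thesis using u assms same[of 0 k x]
        by (auto simp: cartan_def Node_in_V add.commute split: if_splits)
    next
      case v: (Node y l)
      show ?thesis
      proof (cases "x = y")
        case True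
        have "Suc k < l \<or> Suc l < k"
          using True u v assms(6) by (auto simp: cartan_def split: if_splits)
        moreover have "arm_node x k = Node x k" "arm_node x l = Node x l"
          using True u v assms by (auto simp: arm_node_eq_Node Node_in_V)
        ultimately show ?thesis
          using True u v assms same[of k l x] same[of l k x] by (auto simp: Node_in_V add.commute)
      next
        case False
        then show ?thesis using cross[of x y k l] u v assms by (simp add: Node_in_V)
      qed
    qed
  qed
qed

text \<open>Each unordered pair of nonadjacent vertices must be counted once. An arbitrary numbering
  of the vertices decides which of the two vertices takes the pair.\<close>

lemma Pos_vee_in_integral_cone:
  assumes "p \<in> Pos" "q \<in> Pos" "form p q = 0"
  shows "vee p q \<in> integral_cone"
proof -
  obtain f :: "node \<Rightarrow> nat" where f: "inj_on f V"
    using finite_imp_inj_to_nat_seg[OF finite_verts] by blast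
  define R where "R u v = p u * q v + p v * q u - (near_part p q u v + near_part p q v u)" for u v
  define later where "later u = {w \<in> V. cartan u w = 0 \<and> f w < f u}" for u
  define phi where "phi u v = near_part p q u v + (\<Sum>w\<in>later u. R u w * simple_root w v)" for u v
  have fin: "finite (later u)" for u by (simp add: later_def finite_verts)
  have R: "R u w \<in> \<int>" "0 \<le> R u w" if "u \<in> V" "w \<in> later u" for u w
    using that near_part_nonadjacent[OF assms] near_part_Ints[OF assms(1,2)] Pos_Ints assms
    by (auto simp: R_def later_def intro!: Ints_diff Ints_add Ints_mult)
  have phi_cone: "vee (simple_root u) (phi u) \<in> integral_cone" if "u \<in> V" for u
    unfolding phi_def using that R
    by (intro vee_simple_add near_part_in_integral_cone assms vee_simple_sum fin
        vee_simple_elementary_multiple elementary_simple_root) (auto simp: later_def)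
  have phi_later: "phi u v = near_part p q u v + (if v \<in> later u then R u v else 0)" for u v
    using fin[of u]
    by (simp add: phi_def simple_root_def if_distrib[of "\<lambda>t. _ * t"] cong: if_cong)
  have entry: "vee p q i j = (\<Sum>u\<in>V. vee (simple_root u) (phi u) i j)" for i j
  proof -
    have "(\<Sum>u\<in>V. vee (simple_root u) (phi u) i j) =
        (\<Sum>u\<in>V. if u = i then phi i j else 0) + (\<Sum>u\<in>V. if u = j then phi j i else 0)"
      by (subst sum.distrib[symmetric], intro sum.cong)
        (auto simp: vee_def tprod_def simple_root_def)
    also have "\<dots> = (if i \<in> V then phi i j else 0) + (if j \<in> V then phi j i else 0)"
      using finite_verts by simp
    also have "\<dots> = p i * q j + p j * q i"
    proof (cases "i \<in> V \<and> j \<in> V")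
      case True
      show ?thesis
      proof (cases "cartan i j = 0")
        case c: True
        then have "i \<noteq> j" by (auto simp: cartan_def)
        then have "f i \<noteq> f j" using f True by (auto simp: inj_on_def)
        then have "f i < f j \<or> f j < f i" by linarith
        then show ?thesis using True c cartan_sym[of i j] by (auto simp: phi_later later_def R_def)
      next
        case False
        then show ?thesis using True near_part_adjacent[of i j p q] cartan_sym[of i j]
          by (auto simp: phi_later later_def)
      qed
    next
      case False
      then show ?thesis
        using near_part_outside[OF assms(1,2)] Pos_root_space[OF assms(1)] Pos_root_space[OF assms(2)]
        by (auto simp: phi_later later_def)
    qed
    finally show ?thesis by (simp add: vee_def tprod_def mult.commute)
  qed
  have "vee p q = (\<lambda>i j. \<Sum>u\<in>V. vee (simple_root u) (phi u) i j)"
    using entry by (intro ext)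
  then show ?thesis using integral_cone_sum[OF finite_verts phi_cone] by simp
qed

lemma real_root_sign_scalar:
  assumes "v \<in> real_roots a b c"
  obtains e :: real where "e = 1 \<or> e = -1" "(\<lambda>j. e * v j) \<in> Pos"
  using real_root_sign[OF assms] that[of 1] that[of "-1"] by auto

lemma real_two_root_sign:
  assumes "\<xi> \<in> real_two_roots a b c"
  shows "\<xi> \<in> integral_cone \<or> (\<lambda>i j. - \<xi> i j) \<in> integral_cone"
proof -
  obtain \<alpha> \<beta> where \<xi>: "\<xi> = vee \<alpha> \<beta>" and roots: "\<alpha> \<in> real_roots a b c" "\<beta> \<in> real_roots a b c"
    and orth: "form \<alpha> \<beta> = 0"
    using assms unfolding real_two_roots_def by blast
  obtain d where d: "d = 1 \<or> d = -1" "(\<lambda>j. d * \<alpha> j) \<in> Pos"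
    using real_root_sign_scalar[OF roots(1)] .
  obtain e where e: "e = 1 \<or> e = -1" "(\<lambda>j. e * \<beta> j) \<in> Pos"
    using real_root_sign_scalar[OF roots(2)] .
  have "form (\<lambda>j. d * \<alpha> j) (\<lambda>j. e * \<beta> j) = d * e * form \<alpha> \<beta>"
    by (simp add: bform_def sum_distrib_left algebra_simps)
  then have "vee (\<lambda>j. d * \<alpha> j) (\<lambda>j. e * \<beta> j) \<in> integral_cone"
    using Pos_vee_in_integral_cone d e orth by simp
  moreover have "vee (\<lambda>j. d * \<alpha> j) (\<lambda>j. e * \<beta> j) = (\<lambda>i j. d * e * \<xi> i j)"
    by (simp add: \<xi> vee_def tprod_def algebra_simps)
  ultimately show ?thesis using d e by auto
qed

end

theorem theorem5p2:
  fixes a b c :: nat and \<xi> :: tensor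
  assumes "a \<ge> 1" and "b \<ge> 1" and "c \<ge> 1"
    and "\<xi> \<in> real_two_roots a b c"
  shows "\<exists>m :: tensor \<Rightarrow> int.
    (\<forall>i j. \<xi> i j = (\<Sum>x\<in>canonical_basis a b c. real_of_int (m x) * x i j)) \<and>
    ((\<forall>x\<in>canonical_basis a b c. m x \<ge> 0) \<or> (\<forall>x\<in>canonical_basis a b c. m x \<le> 0))"
proof -
  interpret Y_diagram a b c using assms(1-3) by unfold_locales
  from real_two_root_sign[OF assms(4)] show ?thesis
  proof
    assume "\<xi> \<in> integral_cone"
    then show ?thesis unfolding integral_cone_def by blast
  next
    assume "(\<lambda>i j. - \<xi> i j) \<in> integral_cone"
    then obtain m :: "tensor \<Rightarrow> int" where m: "\<forall>x. m x \<ge> 0"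
      "\<forall>i j. - \<xi> i j = (\<Sum>x\<in>canonical_basis a b c. real_of_int (m x) * x i j)"
      unfolding integral_cone_def by blast
    have "\<xi> i j = (\<Sum>x\<in>canonical_basis a b c. real_of_int (- m x) * x i j)" for i j
      using m(2)[rule_format, of i j] by (simp add: sum_negf)
    then show ?thesis using m(1) by (intro exI[of _ "\<lambda>x. - m x"]) simp
  qed
qed

end
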